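(* Let $\{q_n\}_{n=1}^{\infty}$ be a sequence of positive real numbers such that $\lim_{n\to\infty} n(1-q_n)=\beta\in\mathbb{R}$. Then for every continuous function $f:[0,1]\to\mathbb{R}$, $$\lim_{n\to\infty}\max_{i\in[n]}\left|\mu_{n,q_n}\!\left(f\!\left(\tfrac{\pi(i)}{n}\right)\right)-\int_0^1 f(y)\,u\!\left(\tfrac{i}{n},y,\beta\right)dy\right|=0,$$ and $$\lim_{n\to\infty}\max_{\substack{i\neq j\\ i,j\in[n]}}\left|\mathrm{Cov}_n\!\left(f\!\left(\tfrac{\pi(i)}{n}\right),f\!\left(\tfrac{\pi(j)}{n}\right)\right)\right|=0,$$ where $$\mathrm{Cov}_n\!\left(f\!\left(\tfrac{\pi(i)}{n}\right),f\!\left(\tfrac{\pi(j)}{n}\right)\right):=\mu_{n,q_n}\!\left(f\!\left(\tfrac{\pi(i)}{n}\right)f\!\left(\tfrac{\pi(j)}{n}\right)\right)-\mu_{n,q_n}\!\left(f\!\left(\tfrac{\pi(i)}{n}\right)\right)\mu_{n,q_n}\!\left(f\!\left(\tfrac{\pi(j)}{n}\right)\right).$$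
   Context: $[n]=\{1,\dots,n\}$ and $S_n$ is the symmetric group on $[n]$. For $\pi\in S_n$, $l(\pi)=|\{(i,j):1\le i<j\le n,\ \pi(i)>\pi(j)\}|$ is the number of inversions. For $q>0$ the Mallows measure on $S_n$ is the probability measure $\mu_{n,q}(\pi)=q^{l(\pi)}/Z_{n,q}$ with $Z_{n,q}=\sum_{\sigma\in S_n}q^{l(\sigma)}=\prod_{i=1}^n\frac{1-q^i}{1-q}$ (each factor read as $i$ when $q=1$). For a function $g$ on $S_n$, $\mu_{n,q}(g)$ denotes the expectation $\sum_{\pi\in S_n}g(\pi)\mu_{n,q}(\pi)$. For $x,y\in[0,1]$ and $\beta\in\mathbb{R}$, $\beta\ne0$, $$u(x,y,\beta)=\frac{(\beta/2)\sinh(\beta/2)}{\left(e^{\beta/4}\cosh(\beta[x-y]/2)-e^{-\beta/4}\cosh(\beta[x+y-1]/2)\right)^2},$$ and $u(x,y,0):=1$. *)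

theory Defs
  imports "HOL-Analysis.Analysis" "HOL-Combinatorics.Permutations"
begin

(* The symmetric group on {1..n}; its elements are total functions on nat fixing all points
   outside {1..n}. *)
definition sym_perms :: "nat \<Rightarrow> (nat \<Rightarrow> nat) set" where
  "sym_perms n = {p. p permutes {1..n}}"

definition inversion_count :: "nat \<Rightarrow> (nat \<Rightarrow> nat) \<Rightarrow> nat" where
  "inversion_count n p = card {(i, j). 1 \<le> i \<and> i < j \<and> j \<le> n \<and> p i > p j}"

definition mallows_Z :: "nat \<Rightarrow> real \<Rightarrow> real" where
  "mallows_Z n q = (\<Sum>s\<in>sym_perms n. q ^ inversion_count n s)"

definition mallows :: "nat \<Rightarrow> real \<Rightarrow> (nat \<Rightarrow> nat) \<Rightarrow> real" where
  "mallows n q p = q ^ inversion_count n p / mallows_Z n q"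

definition mallows_expectation :: "nat \<Rightarrow> real \<Rightarrow> ((nat \<Rightarrow> nat) \<Rightarrow> real) \<Rightarrow> real" where
  "mallows_expectation n q g = (\<Sum>p\<in>sym_perms n. g p * mallows n q p)"

definition mallows_cov ::
    "nat \<Rightarrow> real \<Rightarrow> ((nat \<Rightarrow> nat) \<Rightarrow> real) \<Rightarrow> ((nat \<Rightarrow> nat) \<Rightarrow> real) \<Rightarrow> real" where
  "mallows_cov n q g h =
     mallows_expectation n q (\<lambda>p. g p * h p)
       - mallows_expectation n q g * mallows_expectation n q h"

definition mallows_density :: "real \<Rightarrow> real \<Rightarrow> real \<Rightarrow> real" where
  "mallows_density x y \<beta> =
     (if \<beta> = 0 then 1
      else ((\<beta> / 2) * sinh (\<beta> / 2)) /
        (exp (\<beta> / 4) * cosh (\<beta> * (x - y) / 2)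
           - exp (- \<beta> / 4) * cosh (\<beta> * (x + y - 1) / 2))\<^sup>2)"

lemma finite_sym_perms: "finite (sym_perms n)"
  unfolding sym_perms_def by (rule finite_permutations) simp

lemma mallows_Z_pos:
  assumes "q > 0"
  shows "mallows_Z n q > 0"
proof -
  have "id \<in> sym_perms n"
    by (simp add: sym_perms_def permutes_id)
  then show ?thesis
    unfolding mallows_Z_def using assms finite_sym_perms by (intro sum_pos) auto
qed

lemma sum_mallows:
  assumes "q > 0"
  shows "(\<Sum>p\<in>sym_perms n. mallows n q p) = 1"
  using mallows_Z_pos[OF assms, of n]
  by (simp add: mallows_def mallows_Z_def flip: sum_divide_distrib)

end

theory Submission
  imports Defs
begin

text \<open>
  Write \<open>[k] = 1 + q + \<dots> + q\<^sup>k\<^sup>-\<^sup>1\<close>.  A Mallows permutation of \<open>n + 1\<close> points is built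
  from its first value \<open>r\<close>, which has probability \<open>q\<^sup>r\<^sup>-\<^sup>1 / [n + 1]\<close>, and an independent Mallows
  permutation of \<open>n\<close> points whose values are relabelled so as to avoid \<open>r\<close>
  (\<open>mallows_expectation_Suc\<close>).  Given \<open>r\<close>, the event "a later value is at most \<open>k\<close>" becomes
  "at most \<open>k - 1\<close>" for the smaller permutation if \<open>r \<le> k\<close>, and otherwise keeps its form.  So the
  probabilities \<open>A(n, i, k)\<close> of "the value at \<open>i\<close> is at most
  \<open>k\<close>" satisfy a closed recursion: \<open>A(n + 1, i + 1, k)\<close> is the average of \<open>A(n, i, k - 1)\<close> and
  \<open>A(n, i, k)\<close> with weights \<open>[k] / [n + 1]\<close> and \<open>1 - [k] / [n + 1]\<close>.

  The function \<open>profile\<close>, that is, with \<open>n = t + m\<close> and \<open>i = t + 1\<close>,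
  \<open>\<Phi>(t, m, k) = q\<^sup>t [k] / (q\<^sup>k [t] + q\<^sup>t [m])\<close>,
  has the right initial value at \<open>i = 1\<close> and satisfies this recursion up to an error that can be
  computed in closed form (\<open>profile_one_step_defect\<close>) and has a factor \<open>1 - q\<close>.  In the regime
  \<open>1 - q = O(1/n)\<close> the errors telescope, and \<open>A\<close> differs from \<open>\<Phi>\<close> by \<open>O(1/n)\<close>, uniformly
  (\<open>mallows_cdf_near_profile\<close>).  In terms of \<open>b = - n ln q\<close>, which tends to \<open>\<beta>\<close>, \<open>\<Phi>\<close> is exactly
  a function \<open>limit_cdf\<close> of \<open>b\<close>, \<open>t / n\<close> and \<open>k / n\<close>.  This function is jointly continuous, also
  at \<open>b = 0\<close>, and its derivative in the last variable is the density \<open>u\<close>.  Hence the distribution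
  functions converge uniformly.

  The covariance of two threshold events obeys the law of total covariance with respect to the first
  value (\<open>mallows_cov_later\<close>).  Every step of the recursion adds a covariance of two quantities that
  vary by \<open>O(1/n)\<close> only, because the profile has jumps of that size.  As long as the earlier of the
  two positions lies in the left half, the recursion ends while the permutations still have at least
  about \<open>n / 2\<close> points, so the \<open>O(n)\<close> steps add up to \<open>O(1/n)\<close>.  Otherwise both positions
  lie in the right half, and reversing the order of positions and of values, which preserves the
  Mallows measure, moves them to the left half.

  Finally, a function of a value is a linear combination of threshold indicators, with coefficients
  \<open>O(1/n)\<close> if the function is Lipschitz.  This yields both limits for Lipschitz functions, and
  continuous functions are uniform limits of polynomials.
\<close>

section \<open>Gaussian integers\<close>

definition qint :: "real \<Rightarrow> nat \<Rightarrow> real" where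
  "qint q k = (\<Sum>i<k. q ^ i)"

lemma qint_0 [simp]: "qint q 0 = 0"
  by (simp add: qint_def)

lemma qint_Suc: "qint q (Suc k) = qint q k + q ^ k"
  by (simp add: qint_def)

lemma qint_Suc': "qint q (Suc k) = 1 + q * qint q k"
  unfolding qint_def sum.lessThan_Suc_shift by (simp add: sum_distrib_left)

lemma qint_add: "qint q (j + k) = qint q j + q ^ j * qint q k"
  by (induction k) (simp_all add: qint_Suc algebra_simps power_add)

lemma one_minus_times_qint: "(1 - q) * qint q k = 1 - q ^ k"
  by (simp add: qint_def one_diff_power_eq)

lemma qint_pos: "q > 0 \<Longrightarrow> k > 0 \<Longrightarrow> qint q k > 0"
  unfolding qint_def by (intro sum_pos) auto

lemma qint_nonneg: "q > 0 \<Longrightarrow> qint q k \<ge> 0"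
  unfolding qint_def by (intro sum_nonneg) auto

lemma sum_power_atLeastAtMost: "(\<Sum>r=1..k. q ^ (r - 1)) = qint q k"
  unfolding qint_def by (rule sum.reindex_bij_witness[of _ Suc "\<lambda>r. r - 1"]) auto

section \<open>Removing the first value of a permutation\<close>

text \<open>
  The increasing enumeration of all numbers except \<open>r\<close>; it relabels the values that follow a first value \<open>r\<close>.
\<close>

definition skip_value :: "nat \<Rightarrow> nat \<Rightarrow> nat" where
  "skip_value r x = (if x < r then x else Suc x)"

definition prepend_value :: "nat \<Rightarrow> nat \<Rightarrow> (nat \<Rightarrow> nat) \<Rightarrow> nat \<Rightarrow> nat" where
  "prepend_value n r s i =
     (if i = 1 then r else if i \<in> {2..Suc n} then skip_value r (s (i - 1)) else i)"

lemma skip_value_less_iff [simp]: "skip_value r x < skip_value r y \<longleftrightarrow> x < y"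
  by (auto simp: skip_value_def)

lemma skip_value_eq_iff [simp]: "skip_value r x = skip_value r y \<longleftrightarrow> x = y"
  by (auto simp: skip_value_def)

lemma skip_value_neq [simp]: "skip_value r x \<noteq> r" "r \<noteq> skip_value r x"
  by (auto simp: skip_value_def)

lemma prepend_value_1 [simp]: "prepend_value n r s (Suc 0) = r"
  by (simp add: prepend_value_def)

lemma prepend_value_Suc:
  "1 \<le> i \<Longrightarrow> i \<le> n \<Longrightarrow> prepend_value n r s (Suc i) = skip_value r (s i)"
  by (simp add: prepend_value_def)

lemma perm_in_range: "p \<in> sym_perms n \<Longrightarrow> i \<in> {1..n} \<Longrightarrow> p i \<in> {1..n}"
  unfolding sym_perms_def using permutes_in_image by fastforce

lemma prepend_value_in_sym_perms:
  assumes "r \<in> {1..Suc n}" "s \<in> sym_perms n"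
  shows "prepend_value n r s \<in> sym_perms (Suc n)"
proof -
  let ?p = "prepend_value n r s"
  have s: "inj s" using assms(2) by (auto simp: sym_perms_def permutes_inj)
  have "inj_on ?p {1..Suc n}"
    using inj_eq[OF s] by (auto simp: inj_on_def prepend_value_def)
  moreover have "?p ` {1..Suc n} \<subseteq> {1..Suc n}"
  proof (rule image_subsetI)
    fix i assume i: "i \<in> {1..Suc n}"
    show "?p i \<in> {1..Suc n}"
    proof (cases "i = 1")
      case True then show ?thesis using assms by simp
    next
      case False
      then have "s (i - 1) \<in> {1..n}" using i by (intro perm_in_range[OF assms(2)]) auto
      then show ?thesis using False i by (auto simp: prepend_value_def skip_value_def)
    qed
  qed
  ultimately have "bij_betw ?p {1..Suc n} {1..Suc n}"
    by (simp add: bij_betw_def endo_inj_surj)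
  then show ?thesis
    unfolding sym_perms_def by (auto intro!: bij_imp_permutes simp: prepend_value_def)
qed

lemma inj_on_prepend_value:
  "inj_on (\<lambda>(r, s). prepend_value n r s) ({1..Suc n} \<times> sym_perms n)"
proof (rule inj_onI, clarify)
  fix r s r' s'
  assume s: "s \<in> sym_perms n" "s' \<in> sym_perms n"
    and eq: "prepend_value n r s = prepend_value n r' s'"
  have r: "r = r'" using fun_cong[OF eq, of "Suc 0"] by simp
  have "s i = s' i" for i
  proof (cases "i \<in> {1..n}")
    case True
    then show ?thesis using fun_cong[OF eq, of "Suc i"] r by (simp add: prepend_value_Suc)
  next
    case False
    then show ?thesis using s unfolding sym_perms_def by (simp add: permutes_def)
  qed
  then show "r = r' \<and> s = s'" using r by auto
qed

lemma card_sym_perms: "card (sym_perms n) = fact n"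
  unfolding sym_perms_def by (rule card_permutations) auto

text \<open>
  Both sides have \<open>(n + 1)!\<close> elements, so injectivity is enough.
\<close>

lemma bij_betw_prepend_value:
  "bij_betw (\<lambda>(r, s). prepend_value n r s) ({1..Suc n} \<times> sym_perms n) (sym_perms (Suc n))"
  unfolding bij_betw_def
proof
  show "(\<lambda>(r, s). prepend_value n r s) ` ({1..Suc n} \<times> sym_perms n) = sym_perms (Suc n)"
  proof (rule card_subset_eq[OF finite_sym_perms])
    show "(\<lambda>(r, s). prepend_value n r s) ` ({1..Suc n} \<times> sym_perms n) \<subseteq> sym_perms (Suc n)"
      using prepend_value_in_sym_perms by auto
    show "card ((\<lambda>(r, s). prepend_value n r s) ` ({1..Suc n} \<times> sym_perms n)) = card (sym_perms (Suc n))"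
      unfolding card_image[OF inj_on_prepend_value]
      by (simp add: card_cartesian_product card_sym_perms)
  qed
qed (rule inj_on_prepend_value)

text \<open>
  The inversions that involve the first position correspond to the \<open>r - 1\<close> values below \<open>r\<close>, all of
  which come later.  The others are those of \<open>s\<close>, since relabelling keeps the order of the values.
\<close>

lemma inversion_count_prepend_value:
  assumes "r \<in> {1..Suc n}" "s \<in> sym_perms n"
  shows "inversion_count (Suc n) (prepend_value n r s) = (r - 1) + inversion_count n s"
proof -
  let ?p = "prepend_value n r s"
  let ?I = "{(i, j). 1 \<le> i \<and> i < j \<and> j \<le> Suc n \<and> ?p i > ?p j}"
  let ?J = "{(i, j). 1 \<le> i \<and> i < j \<and> j \<le> n \<and> s i > s j}"
  let ?V = "{j \<in> {1..n}. s j < r}"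
  have split: "?I = (\<lambda>j. (1, Suc j)) ` ?V \<union> (\<lambda>(i, j). (Suc i, Suc j)) ` ?J" (is "_ = ?A \<union> ?B")
  proof (intro equalityI subsetI)
    fix x assume "x \<in> ?I"
    then obtain i j where x: "x = (i, j)" and ij: "1 \<le> i" "i < j" "j \<le> Suc n" "?p i > ?p j"
      by auto
    obtain j' where j': "j = Suc j'" "1 \<le> j'" "j' \<le> n" using ij by (cases j) auto
    show "x \<in> ?A \<union> ?B"
    proof (cases "i = 1")
      case True
      then have "s j' < r" using ij j' by (auto simp: prepend_value_Suc skip_value_def split: if_splits)
      then show ?thesis using True x j' by auto
    next
      case False
      then obtain i' where i': "i = Suc i'" "1 \<le> i'" using ij by (cases i) auto
      then have "(i', j') \<in> ?J" using ij j' by (auto simp: prepend_value_Suc)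
      then show ?thesis using x i' j' by (auto intro!: image_eqI[of _ _ "(i', j')"])
    qed
  next
    fix x assume "x \<in> ?A \<union> ?B"
    then show "x \<in> ?I"
      by (auto simp: prepend_value_Suc) (auto simp: skip_value_def)
  qed
  have fin: "finite ?J" by (rule finite_subset[of _ "{1..n} \<times> {1..n}"]) auto
  have im: "s ` {1..n} = {1..n}" using assms(2) by (simp add: sym_perms_def permutes_image)
  have "s ` ?V = {x \<in> s ` {1..n}. x < r}" by blast
  also have "\<dots> = {1..<r}" unfolding im using assms(1) by auto
  finally have "s ` ?V = {1..<r}" .
  moreover have "inj_on s ?V" using assms(2) by (auto simp: sym_perms_def permutes_inj_on)
  ultimately have "card ?V = r - 1" by (metis card_image card_atLeastLessThan)
  then have "card ?A = r - 1" by (subst card_image) (auto simp: inj_on_def)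
  moreover have "card ?B = inversion_count n s"
    unfolding inversion_count_def by (subst card_image) (auto simp: inj_on_def)
  moreover have "card (?A \<union> ?B) = card ?A + card ?B"
    using fin by (intro card_Un_disjoint) auto
  ultimately show ?thesis unfolding inversion_count_def split by simp
qed

lemma sum_sym_perms_Suc:
  fixes q :: real
  shows "(\<Sum>p\<in>sym_perms (Suc n). G p * q ^ inversion_count (Suc n) p) =
   (\<Sum>r=1..Suc n. q ^ (r - 1) * (\<Sum>s\<in>sym_perms n. G (prepend_value n r s) * q ^ inversion_count n s))"
  (is "?L = ?R")
proof -
  have "?L = (\<Sum>(r, s)\<in>{1..Suc n} \<times> sym_perms n.
      G (prepend_value n r s) * q ^ inversion_count (Suc n) (prepend_value n r s))"
    by (subst sum.reindex_bij_betw[OF bij_betw_prepend_value, symmetric]) (simp add: case_prod_unfold)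
  also have "\<dots> = (\<Sum>r=1..Suc n. \<Sum>s\<in>sym_perms n.
      G (prepend_value n r s) * q ^ inversion_count (Suc n) (prepend_value n r s))"
    by (simp add: sum.cartesian_product)
  also have "\<dots> = ?R"
  proof (rule sum.cong[OF refl])
    fix r assume r: "r \<in> {1..Suc n}"
    show "(\<Sum>s\<in>sym_perms n. G (prepend_value n r s) * q ^ inversion_count (Suc n) (prepend_value n r s)) =
      q ^ (r - 1) * (\<Sum>s\<in>sym_perms n. G (prepend_value n r s) * q ^ inversion_count n s)"
      unfolding sum_distrib_left
      by (rule sum.cong[OF refl]) (simp only: inversion_count_prepend_value[OF r] power_add mult_ac)
  qed
  finally show ?thesis .
qed

lemma mallows_expectation_eq:
  "mallows_expectation n q g = (\<Sum>p\<in>sym_perms n. g p * q ^ inversion_count n p) / mallows_Z n q"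
  by (simp add: mallows_expectation_def mallows_def sum_divide_distrib)

lemma mallows_Z_Suc: "mallows_Z (Suc n) q = qint q (Suc n) * mallows_Z n q"
  using sum_sym_perms_Suc[of "\<lambda>_. 1" q n]
  unfolding mallows_Z_def sum_distrib_right[symmetric] sum_power_atLeastAtMost by simp

definition first_value_prob :: "real \<Rightarrow> nat \<Rightarrow> nat \<Rightarrow> real" where
  "first_value_prob q n r = q ^ (r - 1) / qint q n"

text \<open>
  The first value has a truncated geometric distribution and is independent of the relative order of
  the rest, which is again a Mallows permutation.  All later recursions are instances of this identity.
\<close>

lemma mallows_expectation_Suc:
  "mallows_expectation (Suc n) q G =
     (\<Sum>r=1..Suc n. first_value_prob q (Suc n) r * mallows_expectation n q (\<lambda>s. G (prepend_value n r s)))"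
  unfolding mallows_expectation_eq sum_sym_perms_Suc mallows_Z_Suc first_value_prob_def
  by (subst sum_divide_distrib) (simp only: times_divide_times_eq)

lemma mallows_expectation_cong:
  "(\<And>p. p \<in> sym_perms n \<Longrightarrow> g p = h p) \<Longrightarrow> mallows_expectation n q g = mallows_expectation n q h"
  unfolding mallows_expectation_def by (intro sum.cong) auto

lemma mallows_expectation_const: "q > 0 \<Longrightarrow> mallows_expectation n q (\<lambda>_. c) = c"
  unfolding mallows_expectation_def by (simp add: sum_mallows flip: sum_distrib_left)

lemma mallows_expectation_add:
  "mallows_expectation n q (\<lambda>p. g p + h p) = mallows_expectation n q g + mallows_expectation n q h"
  unfolding mallows_expectation_def by (simp add: sum.distrib algebra_simps)

lemma mallows_expectation_diff:
  "mallows_expectation n q (\<lambda>p. g p - h p) = mallows_expectation n q g - mallows_expectation n q h"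
  unfolding mallows_expectation_def by (simp add: sum_subtractf algebra_simps)

lemma mallows_expectation_cmult:
  "mallows_expectation n q (\<lambda>p. c * g p) = c * mallows_expectation n q g"
  unfolding mallows_expectation_def by (simp add: sum_distrib_left mult.assoc)

lemma mallows_expectation_sum:
  "mallows_expectation n q (\<lambda>p. \<Sum>k\<in>S. g k p) = (\<Sum>k\<in>S. mallows_expectation n q (g k))"
  unfolding mallows_expectation_def sum_distrib_right by (rule sum.swap)

lemma abs_mallows_expectation_le:
  assumes "q > 0" and "\<And>p. p \<in> sym_perms n \<Longrightarrow> \<bar>g p\<bar> \<le> c"
  shows "\<bar>mallows_expectation n q g\<bar> \<le> c"
proof -
  have nonneg: "mallows n q p \<ge> 0" for p
    using assms(1) mallows_Z_pos[OF assms(1), of n] by (simp add: mallows_def)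
  have "\<bar>mallows_expectation n q g\<bar> \<le> (\<Sum>p\<in>sym_perms n. \<bar>g p\<bar> * mallows n q p)"
    unfolding mallows_expectation_def
    by (rule order_trans[OF sum_abs]) (simp add: abs_mult nonneg)
  also have "\<dots> \<le> (\<Sum>p\<in>sym_perms n. c * mallows n q p)"
    by (intro sum_mono mult_right_mono assms nonneg)
  also have "\<dots> = c" by (simp add: sum_mallows[OF assms(1)] flip: sum_distrib_left)
  finally show ?thesis .
qed

section \<open>Threshold events and the law of total covariance\<close>

definition at_most :: "nat \<Rightarrow> nat \<Rightarrow> (nat \<Rightarrow> nat) \<Rightarrow> real" where
  "at_most i k p = of_bool (p i \<le> k)"

definition mallows_cdf :: "real \<Rightarrow> nat \<Rightarrow> nat \<Rightarrow> nat \<Rightarrow> real" where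
  "mallows_cdf q n i k = mallows_expectation n q (at_most i k)"

lemma first_value_prob_nonneg: "q > 0 \<Longrightarrow> first_value_prob q n r \<ge> 0"
  by (simp add: first_value_prob_def qint_nonneg)

lemma sum_first_value_prob_le:
  assumes "k \<le> n"
  shows "(\<Sum>r=1..n. first_value_prob q n r * of_bool (r \<le> k)) = qint q k / qint q n"
proof -
  have "(\<Sum>r=1..n. first_value_prob q n r * of_bool (r \<le> k)) = (\<Sum>r=1..k. q ^ (r - 1) / qint q n)"
    using assms by (intro sum.mono_neutral_cong_right) (auto simp: first_value_prob_def)
  then show ?thesis by (simp only: sum_power_atLeastAtMost sum_divide_distrib[symmetric])
qed

lemma sum_first_value_prob:
  assumes "q > 0" "n > 0"
  shows "(\<Sum>r=1..n. first_value_prob q n r) = 1"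
proof -
  have "(\<Sum>r=1..n. first_value_prob q n r) = (\<Sum>r=1..n. first_value_prob q n r * of_bool (r \<le> n))"
    by (intro sum.cong) auto
  also have "\<dots> = 1" using qint_pos[OF assms] by (simp only: sum_first_value_prob_le[OF order_refl]) simp
  finally show ?thesis .
qed

text \<open>
  Averaging over the first value sees a threshold \<open>k\<close> only through the event \<open>r \<le> k\<close>, of
  probability \<open>[k] / [n]\<close>, in which the threshold drops by one.
\<close>

lemma sum_first_value_prob_threshold:
  assumes "q > 0" "k \<le> n" "n > 0"
  shows "(\<Sum>r=1..n. first_value_prob q n r * G (k - of_bool (r \<le> k))) =
     qint q k / qint q n * G (k - 1) + (1 - qint q k / qint q n) * G k"
proof -
  have "(\<Sum>r=1..n. first_value_prob q n r * G (k - of_bool (r \<le> k))) =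
    (\<Sum>r=1..n. first_value_prob q n r * G k + (first_value_prob q n r * of_bool (r \<le> k)) * (G (k - 1) - G k))"
    by (intro sum.cong refl) (auto simp: algebra_simps)
  also have "\<dots> = G k + qint q k / qint q n * (G (k - 1) - G k)"
    unfolding sum.distrib sum_distrib_right[symmetric] sum_first_value_prob[OF assms(1,3)]
      sum_first_value_prob_le[OF assms(2)] by simp
  finally show ?thesis by (simp add: algebra_simps)
qed

lemma skip_value_le_iff: "r \<ge> 1 \<Longrightarrow> skip_value r x \<le> k \<longleftrightarrow> x \<le> k - of_bool (r \<le> k)"
  by (auto simp: skip_value_def)

lemma at_most_first: "at_most (Suc 0) k (prepend_value n r s) = of_bool (r \<le> k)"
  by (simp add: at_most_def)

lemma at_most_later:
  assumes "r \<in> {1..Suc n}" "1 \<le> i" "i \<le> n"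
  shows "at_most (Suc i) k (prepend_value n r s) = at_most i (k - of_bool (r \<le> k)) s"
  using assms by (simp add: at_most_def prepend_value_Suc skip_value_le_iff)

lemma mallows_cdf_first:
  assumes "q > 0"
  shows "mallows_cdf q (Suc n) (Suc 0) k = (\<Sum>r=1..Suc n. first_value_prob q (Suc n) r * of_bool (r \<le> k))"
  unfolding mallows_cdf_def mallows_expectation_Suc at_most_first mallows_expectation_const[OF assms] ..

lemma mallows_cdf_later:
  assumes "1 \<le> i" "i \<le> n"
  shows "mallows_cdf q (Suc n) (Suc i) k =
    (\<Sum>r=1..Suc n. first_value_prob q (Suc n) r * mallows_cdf q n i (k - of_bool (r \<le> k)))"
  unfolding mallows_cdf_def mallows_expectation_Suc
  by (intro sum.cong refl) (simp only: at_most_later[OF _ assms])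

lemma mallows_cdf_0: "i \<in> {1..n} \<Longrightarrow> mallows_cdf q n i 0 = 0"
proof -
  assume i: "i \<in> {1..n}"
  have "mallows_cdf q n i 0 = mallows_expectation n q (\<lambda>_. 0)"
    unfolding mallows_cdf_def
    by (intro mallows_expectation_cong) (use perm_in_range[OF _ i] in \<open>fastforce simp: at_most_def\<close>)
  then show ?thesis by (simp add: mallows_expectation_def)
qed

lemma mallows_cdf_top:
  assumes "q > 0" "i \<in> {1..n}" "n \<le> k"
  shows "mallows_cdf q n i k = 1"
proof -
  have "mallows_cdf q n i k = mallows_expectation n q (\<lambda>_. 1)"
    unfolding mallows_cdf_def
    by (intro mallows_expectation_cong)
      (use perm_in_range[OF _ assms(2)] assms(3) in \<open>fastforce simp: at_most_def\<close>)
  then show ?thesis by (simp add: mallows_expectation_const assms)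
qed

text \<open>
  Law of total covariance: the first sum is the expected conditional covariance given the first
  value, and the rest is the covariance of the two conditional expectations.
\<close>

lemma mallows_cov_later:
  fixes q :: real
  assumes i: "1 \<le> i" "i \<le> n" and j: "1 \<le> j" "j \<le> n"
  defines "w \<equiv> first_value_prob q (Suc n)"
  defines "k' \<equiv> \<lambda>k r. k - of_bool (r \<le> k)"
  shows "mallows_cov (Suc n) q (at_most (Suc i) k) (at_most (Suc j) l) =
     (\<Sum>r=1..Suc n. w r * mallows_cov n q (at_most i (k' k r)) (at_most j (k' l r)))
     + ((\<Sum>r=1..Suc n. w r * (mallows_cdf q n i (k' k r) * mallows_cdf q n j (k' l r)))
        - (\<Sum>r=1..Suc n. w r * mallows_cdf q n i (k' k r))
          * (\<Sum>r=1..Suc n. w r * mallows_cdf q n j (k' l r)))"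
proof -
  have joint: "mallows_expectation (Suc n) q (\<lambda>p. at_most (Suc i) k p * at_most (Suc j) l p) =
      (\<Sum>r=1..Suc n. w r * mallows_expectation n q (\<lambda>s. at_most i (k' k r) s * at_most j (k' l r) s))"
    unfolding mallows_expectation_Suc w_def k'_def
    by (intro sum.cong refl) (simp only: at_most_later[OF _ i] at_most_later[OF _ j])
  show ?thesis
    unfolding mallows_cov_def joint
    unfolding mallows_cdf_def[symmetric] mallows_cdf_later[OF i] mallows_cdf_later[OF j]
      w_def k'_def right_diff_distrib sum_subtractf by (simp del: sum.cl_ivl_Suc)
qed

text \<open>
  When one of the positions is the first one, only the covariance of the conditional expectations remains.
\<close>

lemma mallows_cov_first:
  fixes q :: real
  assumes "q > 0" and j: "1 \<le> j" "j \<le> n"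
  defines "w \<equiv> first_value_prob q (Suc n)"
  defines "k' \<equiv> \<lambda>k r. k - of_bool (r \<le> k)"
  shows "mallows_cov (Suc n) q (at_most (Suc 0) k) (at_most (Suc j) l) =
     (\<Sum>r=1..Suc n. w r * (of_bool (r \<le> k) * mallows_cdf q n j (k' l r)))
        - (\<Sum>r=1..Suc n. w r * of_bool (r \<le> k))
          * (\<Sum>r=1..Suc n. w r * mallows_cdf q n j (k' l r))"
proof -
  have joint: "mallows_expectation (Suc n) q (\<lambda>p. at_most (Suc 0) k p * at_most (Suc j) l p) =
      (\<Sum>r=1..Suc n. w r * (of_bool (r \<le> k) * mallows_cdf q n j (k' l r)))"
    unfolding mallows_expectation_Suc w_def k'_def mallows_cdf_def mallows_expectation_cmult[symmetric]
    by (intro sum.cong refl) (simp only: at_most_later[OF _ j] at_most_first)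
  show ?thesis
    unfolding mallows_cov_def joint
    unfolding mallows_cdf_def[symmetric] mallows_cdf_first[OF assms(1)] mallows_cdf_later[OF j]
      w_def k'_def ..
qed

text \<open>
  Covariance ignores constant shifts, so two quantities of small oscillation have small covariance.
\<close>

lemma weighted_covariance_bound:
  fixes w X Y :: "'a \<Rightarrow> real"
  assumes w: "\<And>r. r \<in> S \<Longrightarrow> w r \<ge> 0" "sum w S = 1"
    and X: "\<And>r. r \<in> S \<Longrightarrow> \<bar>X r - x\<bar> \<le> a" and Y: "\<And>r. r \<in> S \<Longrightarrow> \<bar>Y r - y\<bar> \<le> b"
  shows "\<bar>(\<Sum>r\<in>S. w r * (X r * Y r)) - (\<Sum>r\<in>S. w r * X r) * (\<Sum>r\<in>S. w r * Y r)\<bar> \<le> 2 * a * b"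
proof -
  have avg: "\<bar>\<Sum>r\<in>S. w r * Z r\<bar> \<le> c" if "\<And>r. r \<in> S \<Longrightarrow> \<bar>Z r\<bar> \<le> c" for Z c
  proof -
    have "\<bar>\<Sum>r\<in>S. w r * Z r\<bar> \<le> (\<Sum>r\<in>S. w r * c)"
      by (rule order_trans[OF sum_abs]) (auto intro!: sum_mono mult_left_mono simp: abs_mult w that)
    then show ?thesis by (simp add: w flip: sum_distrib_right)
  qed
  have shift: "(\<Sum>r\<in>S. w r * (Z r - z)) = (\<Sum>r\<in>S. w r * Z r) - z" for Z z
    by (simp add: right_diff_distrib sum_subtractf w flip: sum_distrib_right)
  \<comment> \<open>Centring at \<open>x\<close> and \<open>y\<close> leaves the covariance unchanged.\<close>
  have "(\<Sum>r\<in>S. w r * ((X r - x) * (Y r - y))) =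
      (\<Sum>r\<in>S. w r * (X r * Y r) - y * (w r * X r) - x * (w r * Y r) + x * y * w r)"
    by (intro sum.cong refl) (simp add: algebra_simps)
  also have "\<dots> = (\<Sum>r\<in>S. w r * (X r * Y r)) - y * (\<Sum>r\<in>S. w r * X r)
      - x * (\<Sum>r\<in>S. w r * Y r) + x * y"
    by (simp add: sum.distrib sum_subtractf w flip: sum_distrib_left)
  finally have eq: "(\<Sum>r\<in>S. w r * (X r * Y r)) - (\<Sum>r\<in>S. w r * X r) * (\<Sum>r\<in>S. w r * Y r) =
      (\<Sum>r\<in>S. w r * ((X r - x) * (Y r - y))) - (\<Sum>r\<in>S. w r * (X r - x)) * (\<Sum>r\<in>S. w r * (Y r - y))"
    unfolding shift by (simp add: algebra_simps)
  have ab: "\<bar>(X r - x) * (Y r - y)\<bar> \<le> a * b" if "r \<in> S" for r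
    unfolding abs_mult using X[OF that] Y[OF that] by (intro mult_mono) auto
  have "\<bar>\<Sum>r\<in>S. w r * (X r - x)\<bar> \<le> a" "\<bar>\<Sum>r\<in>S. w r * (Y r - y)\<bar> \<le> b"
    using X Y by (intro avg, simp)+
  then have "\<bar>(\<Sum>r\<in>S. w r * (X r - x)) * (\<Sum>r\<in>S. w r * (Y r - y))\<bar> \<le> a * b"
    unfolding abs_mult by (intro mult_mono) auto
  moreover have "\<bar>\<Sum>r\<in>S. w r * ((X r - x) * (Y r - y))\<bar> \<le> a * b" by (rule avg[OF ab])
  ultimately show ?thesis unfolding eq by linarith
qed

text \<open>
  Unfolding the law of total covariance down to the first position.  If adjacent values of every
  distribution function met on the way differ by at most \<open>J\<close>, then each of the \<open>i - 1\<close> steps costs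
  \<open>O(J\<^sup>2)\<close>, as both conditional expectations oscillate by at most \<open>J\<close>; the last step costs \<open>O(J)\<close>,
  as one of them is then an indicator.  The bound \<open>M\<close> keeps the sizes \<open>n\<close> that occur from getting
  too small for \<open>J\<close> to be small.
\<close>

lemma abs_mallows_cov_at_most_le:
  fixes J :: real
  assumes q: "q > 0"
    and jump: "\<And>n i k. M \<le> n \<Longrightarrow> n \<le> N \<Longrightarrow> 1 \<le> i \<Longrightarrow> i \<le> n \<Longrightarrow>
      \<bar>mallows_cdf q n i (k - 1) - mallows_cdf q n i k\<bar> \<le> J"
    and "1 \<le> i" "i < j" "j \<le> n" "n \<le> N" "M + i \<le> n"
  shows "\<bar>mallows_cov n q (at_most i k) (at_most j l)\<bar> \<le> 2 * J + real (i - 1) * (2 * J * J)"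
  using assms(3-)
proof (induction i arbitrary: n j k l)
  case 0
  then show ?case by simp
next
  case (Suc i)
  obtain n' j' where n': "n = Suc n'" and j': "j = Suc j'" "1 \<le> j'" "j' \<le> n'"
    using Suc.prems by (cases n; cases j) auto
  have M: "M \<le> n'" "n' \<le> N" using Suc.prems n' by auto
  have w: "first_value_prob q (Suc n') r \<ge> 0" "(\<Sum>r=1..Suc n'. first_value_prob q (Suc n') r) = 1" for r
    using q by (intro first_value_prob_nonneg sum_first_value_prob; simp)+
  have "0 \<le> J" using jump[OF M, of 1] j' by fastforce
  then have jump': "\<bar>mallows_cdf q n' a (c - of_bool (r \<le> c)) - mallows_cdf q n' a c\<bar> \<le> J"
    if "1 \<le> a" "a \<le> n'" for a c r
    using jump[OF M that, of c] by auto
  show ?case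
  proof (cases "i = 0")
    case True
    have "\<bar>mallows_cov n q (at_most (Suc i) k) (at_most j l)\<bar> \<le> 2 * 1 * J"
      unfolding True n' j'(1) mallows_cov_first[OF q j'(2,3)]
      by (intro weighted_covariance_bound[of _ _ _ 0 _ _ "mallows_cdf q n' j' l"] w jump' j') auto
    then show ?thesis by (simp add: True)
  next
    case False
    then have i: "1 \<le> i" "i < j'" "i \<le> n'" "M + i \<le> n'" using Suc.prems n' j' by auto
    have IH: "\<bar>mallows_cov n' q (at_most i c) (at_most j' d)\<bar> \<le> 2 * J + real (i - 1) * (2 * J * J)" for c d
      by (rule Suc.IH) (use i j' M in auto)
    let ?w = "first_value_prob q (Suc n')" and ?k = "\<lambda>k r. k - of_bool (r \<le> k) :: nat"
    have "\<bar>\<Sum>r=1..Suc n'. ?w r * mallows_cov n' q (at_most i (?k k r)) (at_most j' (?k l r))\<bar>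
        \<le> (\<Sum>r=1..Suc n'. ?w r * (2 * J + real (i - 1) * (2 * J * J)))"
      by (rule order_trans[OF sum_abs])
        (intro sum_mono, simp only: abs_mult abs_of_nonneg[OF w(1)], intro mult_left_mono IH w(1))
    also have "\<dots> = 2 * J + real (i - 1) * (2 * J * J)"
      by (simp only: w flip: sum_distrib_right) simp
    finally have 1: "\<bar>\<Sum>r=1..Suc n'. ?w r * mallows_cov n' q (at_most i (?k k r)) (at_most j' (?k l r))\<bar>
        \<le> 2 * J + real (i - 1) * (2 * J * J)" .
    have 2: "\<bar>(\<Sum>r=1..Suc n'. ?w r * (mallows_cdf q n' i (?k k r) * mallows_cdf q n' j' (?k l r)))
        - (\<Sum>r=1..Suc n'. ?w r * mallows_cdf q n' i (?k k r))
          * (\<Sum>r=1..Suc n'. ?w r * mallows_cdf q n' j' (?k l r))\<bar> \<le> 2 * J * J"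
      by (intro weighted_covariance_bound[of _ _ _ "mallows_cdf q n' i k" _ _ "mallows_cdf q n' j' l"]
          w jump' i j')
    have "real (Suc i - 1) = real (i - 1) + 1" using i by simp
    then have "2 * J + real (Suc i - 1) * (2 * J * J) = (2 * J + real (i - 1) * (2 * J * J)) + 2 * J * J"
      by (simp only: distrib_right)
    then show ?thesis
      unfolding n' j'(1) mallows_cov_later[OF i(1,3) j'(2,3)]
      using abs_triangle_ineq 1 2 by (smt (verit))
  qed
qed

section \<open>Symmetry under reversal\<close>

definition reflect :: "nat \<Rightarrow> nat \<Rightarrow> nat" where
  "reflect n i = (if i \<in> {1..n} then n + 1 - i else i)"

lemma reflect_reflect [simp]: "reflect n (reflect n i) = i"
  by (auto simp: reflect_def)

lemma reflect_permutes: "reflect n permutes {1..n}"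
  by (rule bij_imp_permutes)
    (auto simp: reflect_def intro!: bij_betwI[of _ _ _ "reflect n"])

lemma reflect_conj_in_sym_perms:
  "p \<in> sym_perms n \<Longrightarrow> reflect n \<circ> p \<circ> reflect n \<in> sym_perms n"
  unfolding sym_perms_def mem_Collect_eq by (intro permutes_compose reflect_permutes)

text \<open>
  Reversing both positions and values inverts the order twice, so inversions go to inversions.
\<close>

lemma inversion_count_reflect_conj:
  assumes p: "p \<in> sym_perms n"
  shows "inversion_count n (reflect n \<circ> p \<circ> reflect n) = inversion_count n p"
  unfolding inversion_count_def
proof (rule bij_betw_same_card[of "\<lambda>(i, j). (reflect n j, reflect n i)"],
    rule bij_betwI[of _ _ _ "\<lambda>(i, j). (reflect n j, reflect n i)"])
  have rng: "p a \<ge> 1" "p a \<le> n" if "1 \<le> a" "a \<le> n" for a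
    using perm_in_range[OF p, of a] that by auto
  have refl: "1 \<le> reflect n a \<and> reflect n a \<le> n" if "1 \<le> a" "a \<le> n" for a
    using that by (auto simp: reflect_def)
  have less: "reflect n a < reflect n b \<longleftrightarrow> b < a" if "1 \<le> a" "a \<le> n" "1 \<le> b" "b \<le> n" for a b
    using that by (auto simp: reflect_def)
  let ?I = "{(i, j). 1 \<le> i \<and> i < j \<and> j \<le> n \<and> p i > p j}"
  let ?I' = "{(i, j). 1 \<le> i \<and> i < j \<and> j \<le> n \<and> (reflect n \<circ> p \<circ> reflect n) i > (reflect n \<circ> p \<circ> reflect n) j}"
  show "(\<lambda>(i, j). (reflect n j, reflect n i)) \<in> ?I' \<rightarrow> ?I"
    using refl less rng by fastforce
  show "(\<lambda>(i, j). (reflect n j, reflect n i)) \<in> ?I \<rightarrow> ?I'"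
    using refl less rng by fastforce
qed auto

lemma mallows_expectation_reflect:
  "mallows_expectation n q g = mallows_expectation n q (\<lambda>p. g (reflect n \<circ> p \<circ> reflect n))"
proof -
  have invol: "reflect n \<circ> (reflect n \<circ> p \<circ> reflect n) \<circ> reflect n = p" for p
    by (simp add: fun_eq_iff)
  show ?thesis
    unfolding mallows_expectation_def mallows_def
    by (rule sum.reindex_bij_witness[of _ "\<lambda>p. reflect n \<circ> p \<circ> reflect n" "\<lambda>p. reflect n \<circ> p \<circ> reflect n"])
      (simp_all only: invol reflect_conj_in_sym_perms inversion_count_reflect_conj)
qed

lemma mallows_cov_one_minus:
  assumes "q > 0"
  shows "mallows_cov n q (\<lambda>p. 1 - g p) (\<lambda>p. 1 - h p) = mallows_cov n q g h"
proof -
  have "(\<lambda>p. (1 - g p) * (1 - h p)) = (\<lambda>p. 1 - g p - h p + g p * h p)"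
    by (auto simp: algebra_simps)
  then show ?thesis
    by (simp add: mallows_cov_def mallows_expectation_add mallows_expectation_diff
        mallows_expectation_const[OF assms] algebra_simps)
qed

text \<open>
  Reversal turns a threshold event into the complement of a threshold event, and passing to both
  complements does not change a covariance.
\<close>

lemma mallows_cov_reflect:
  assumes "q > 0" "i \<in> {1..n}" "j \<in> {1..n}" "k \<le> n" "l \<le> n"
  shows "mallows_cov n q (at_most i k) (at_most j l) =
    mallows_cov n q (at_most (n + 1 - i) (n - k)) (at_most (n + 1 - j) (n - l))"
proof -
  have eq: "at_most a c (reflect n \<circ> p \<circ> reflect n) = 1 - at_most (n + 1 - a) (n - c) p"
    if "p \<in> sym_perms n" "a \<in> {1..n}" "c \<le> n" for a c p
  proof -
    have "p (n + 1 - a) \<in> {1..n}" using that by (intro perm_in_range[OF that(1)]) auto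
    then have "reflect n (p (reflect n a)) = n + 1 - p (n + 1 - a)" "p (n + 1 - a) \<le> n"
      using that by (auto simp: reflect_def)
    then show ?thesis using that by (auto simp: at_most_def)
  qed
  have "mallows_cov n q (at_most i k) (at_most j l) =
    mallows_cov n q (\<lambda>p. at_most i k (reflect n \<circ> p \<circ> reflect n)) (\<lambda>p. at_most j l (reflect n \<circ> p \<circ> reflect n))"
    unfolding mallows_cov_def mallows_expectation_reflect[of n q "at_most i k"]
      mallows_expectation_reflect[of n q "at_most j l"]
      mallows_expectation_reflect[of n q "\<lambda>p. at_most i k p * at_most j l p"] ..
  also have "\<dots> = mallows_cov n q (\<lambda>p. 1 - at_most (n + 1 - i) (n - k) p) (\<lambda>p. 1 - at_most (n + 1 - j) (n - l) p)"
    unfolding mallows_cov_def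
    by (intro arg_cong2[where f = "(-)"] arg_cong2[where f = "(*)"] mallows_expectation_cong)
      (simp_all only: eq assms)
  finally show ?thesis by (simp only: mallows_cov_one_minus[OF assms(1)])
qed

lemma mallows_cov_commute: "mallows_cov n q g h = mallows_cov n q h g"
  by (simp add: mallows_cov_def mult.commute)

section \<open>The approximate solution of the recursion\<close>

text \<open>
  The normalisation that makes the profile a distribution function: for \<open>k = t + m\<close> it equals
  \<open>q\<^sup>t [t + m]\<close>.
\<close>

definition profile_denom :: "real \<Rightarrow> nat \<Rightarrow> nat \<Rightarrow> nat \<Rightarrow> real" where
  "profile_denom q t m k = q ^ k * qint q t + q ^ t * qint q m"

text \<open>
  The approximate probability that position \<open>t + 1\<close> of a Mallows permutation of \<open>t + m\<close> points has a
  value of at most \<open>k\<close>.  The formula comes from the number \<open>N\<close> of values \<open>\<le> k\<close> that the first \<open>t\<close>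
  positions leave unused: given \<open>N\<close>, the probability is \<open>[N] / [m]\<close>, and \<open>V = q\<^sup>-\<^sup>N [N]\<close> has the
  exact mean \<open>q\<^sup>t\<^sup>-\<^sup>k [k] [m] / [t + m]\<close>.  Expressing \<open>[N]\<close> by \<open>V\<close> and replacing \<open>V\<close> by its mean
  gives the profile.  Using \<open>t\<close> and \<open>m\<close> as parameters is convenient as the recursion keeps \<open>m\<close> fixed.
\<close>

definition profile :: "real \<Rightarrow> nat \<Rightarrow> nat \<Rightarrow> nat \<Rightarrow> real" where
  "profile q t m k = q ^ t * qint q k / profile_denom q t m k"

lemma profile_denom_pos: "q > 0 \<Longrightarrow> m > 0 \<Longrightarrow> profile_denom q t m k > 0"
  unfolding profile_denom_def using qint_pos[of q m] qint_nonneg[of q t]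
  by (intro add_nonneg_pos mult_nonneg_nonneg mult_pos_pos) auto

lemma profile_at_0 [simp]: "profile q t m 0 = 0"
  by (simp add: profile_def)

lemma profile_top:
  assumes "q > 0" "m > 0"
  shows "profile q t m (t + m) = 1"
proof -
  have "qint q (t + m) = qint q m + q ^ m * qint q t"
    by (metis add.commute qint_add)
  then have "q ^ t * qint q (t + m) = profile_denom q t m (t + m)"
    by (simp add: profile_denom_def power_add algebra_simps)
  then show ?thesis using profile_denom_pos[OF assms, of t "t + m"] by (simp add: profile_def)
qed

lemma profile_first: "q > 0 \<Longrightarrow> profile q 0 m k = qint q k / qint q m"
  by (simp add: profile_def profile_denom_def)

lemma profile_diff_value:
  assumes "q > 0" "m > 0"
  shows "profile q t m (Suc k) - profile q t m k =
    q ^ t * q ^ k * qint q (t + m) / (profile_denom q t m k * profile_denom q t m (Suc k))"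
proof -
  have "profile q t m (Suc k) - profile q t m k =
    (q ^ t * qint q (Suc k) * profile_denom q t m k - q ^ t * qint q k * profile_denom q t m (Suc k))
      / (profile_denom q t m k * profile_denom q t m (Suc k))"
    using profile_denom_pos[OF assms, of t k] profile_denom_pos[OF assms, of t "Suc k"]
    unfolding profile_def by (simp add: field_simps)
  also have "q ^ t * qint q (Suc k) * profile_denom q t m k - q ^ t * qint q k * profile_denom q t m (Suc k)
    = q ^ t * q ^ k * qint q (t + m) + q ^ t * q ^ k * qint q t * (qint q k - q * qint q k - 1 + q ^ k)"
    unfolding profile_denom_def qint_add by (simp add: qint_Suc algebra_simps)
  also have "qint q k - q * qint q k - 1 + q ^ k = 0"
    using one_minus_times_qint[of q k] by (simp add: algebra_simps)
  finally show ?thesis by simp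
qed

lemma profile_diff_position:
  assumes "q > 0" "m > 0"
  shows "profile q t m k - profile q (Suc t) m k =
    q ^ t * q ^ k * qint q k / (profile_denom q t m k * profile_denom q (Suc t) m k)"
proof -
  have "profile q t m k - profile q (Suc t) m k =
    q ^ t * qint q k * (profile_denom q (Suc t) m k - q * profile_denom q t m k)
      / (profile_denom q t m k * profile_denom q (Suc t) m k)"
    using profile_denom_pos[OF assms, of t k] profile_denom_pos[OF assms, of "Suc t" k]
    unfolding profile_def by (simp add: field_simps)
  also have "profile_denom q (Suc t) m k - q * profile_denom q t m k = q ^ k"
    unfolding profile_denom_def qint_Suc' by (simp add: algebra_simps)
  finally show ?thesis by (simp add: mult_ac)
qed

text \<open>
  The difference between the two sides of the recursion factors completely.  The factor \<open>1 - q\<close>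
  is essential: the profile solves the recursion exactly for \<open>q = 1\<close>.
\<close>

lemma profile_one_step_defect:
  fixes t m k j :: nat
  assumes "q > 0" "m > 0" "t + m = k + j"
  defines "n \<equiv> t + m"
  defines "p \<equiv> qint q (Suc k) / qint q (Suc n)"
  shows "p * profile q t m k + (1 - p) * profile q t m (Suc k) - profile q (Suc t) m (Suc k) =
    - ((1 - q) * qint q m * (q ^ t * q ^ t * q ^ k * q ^ k * q) * qint q (Suc k) * qint q j)
      / (profile_denom q t m k * profile_denom q t m (Suc k) * profile_denom q (Suc t) m (Suc k)
         * qint q (Suc n))"
proof -
  define D where "D = profile_denom q t m k"
  define D1 where "D1 = profile_denom q t m (Suc k)"
  define D2 where "D2 = profile_denom q (Suc t) m (Suc k)"
  define N where "N = qint q (Suc n)"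
  have pos: "D > 0" "D1 > 0" "D2 > 0" "N > 0"
    unfolding D_def D1_def D2_def N_def by (simp_all add: profile_denom_pos assms(1,2) qint_pos)
  have "p * profile q t m k + (1 - p) * profile q t m (Suc k) - profile q (Suc t) m (Suc k) =
     (profile q t m (Suc k) - profile q (Suc t) m (Suc k)) - p * (profile q t m (Suc k) - profile q t m k)"
    by (simp add: algebra_simps)
  also have "\<dots> = q ^ t * q ^ Suc k * qint q (Suc k) / (D1 * D2)
       - qint q (Suc k) / N * (q ^ t * q ^ k * qint q n / (D * D1))"
    unfolding profile_diff_position[OF assms(1,2)] profile_diff_value[OF assms(1,2)] p_def
      D_def D1_def D2_def N_def n_def ..
  also have "\<dots> = q ^ t * q ^ k * qint q (Suc k) * (q * N * D - qint q n * D2) / (D * D1 * D2 * N)"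
    using pos by (simp add: field_simps)
  \<comment> \<open>The two products agree for \<open>k = n\<close>; the relations \<open>(1 - q) [j] = 1 - q\<^sup>j\<close> extract the factor \<open>[n - k]\<close>.\<close>
  also have "q * N * D - qint q n * D2 = - ((1 - q) * qint q m * (q ^ t * q ^ k * q) * qint q j)"
  proof -
    define a where "a = qint q t"
    define b where "b = qint q m"
    define x where "x = q ^ t"
    define y where "y = q ^ k"
    have qn: "qint q n = a + x * b" unfolding n_def qint_add a_def b_def x_def ..
    have a: "(1 - q) * a = 1 - x" unfolding a_def x_def by (rule one_minus_times_qint)
    have "y * ((1 - q) * qint q j) = y * (1 - q ^ j)" by (simp only: one_minus_times_qint)
    also have "\<dots> = y - q ^ n" unfolding y_def n_def assms(3) by (simp add: power_add algebra_simps)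
    also have "q ^ n = 1 - (1 - q) * (a + x * b)" unfolding qn[symmetric] by (simp add: one_minus_times_qint)
    finally have j: "y * ((1 - q) * qint q j) = y - 1 + (1 - q) * (a + x * b)" by simp
    have "q * N * D - qint q n * D2
      = q * (1 + q * (a + x * b)) * (y * a + x * b) - (a + x * b) * (q * y * (1 + q * a) + q * x * b)"
      unfolding N_def D_def D2_def profile_denom_def qint_Suc' qn
      unfolding a_def[symmetric] b_def[symmetric] by (simp add: x_def y_def)
    also have "\<dots> = - (b * x * q) * (y - 1 + (1 - q) * (a + x * b))
        + q * x * b * (y * ((1 - q) * a - (1 - x)))"
      using a by algebra
    finally show ?thesis unfolding a unfolding j[symmetric] b_def[symmetric] x_def[symmetric] y_def[symmetric]
      by (simp add: algebra_simps)
  qed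
  finally show ?thesis unfolding D_def D1_def D2_def N_def by (simp add: mult_ac)
qed

section \<open>Quantitative bounds when all powers of \<open>q\<close> are comparable\<close>

text \<open>
  In the regime \<open>n (1 - q) \<rightarrow> \<beta>\<close> all powers of \<open>q\<close> up to \<open>n\<close> lie between two positive constants, and
  this suffices to compare Gaussian integers with ordinary ones.
\<close>

definition powers_within :: "real \<Rightarrow> real \<Rightarrow> nat \<Rightarrow> bool" where
  "powers_within K q N \<longleftrightarrow> 0 < q \<and> 0 < K \<and> (\<forall>j\<le>N. 1 / K \<le> q ^ j \<and> q ^ j \<le> K)"

lemma powers_withinD:
  assumes "powers_within K q N" "j \<le> N"
  shows "1 / K \<le> q ^ j" "q ^ j \<le> K"
  using assms by (auto simp: powers_within_def)

lemma powers_within_pos: "powers_within K q N \<Longrightarrow> 0 < q" "powers_within K q N \<Longrightarrow> 1 \<le> K"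
  by (auto simp: powers_within_def)

lemma qint_bounds:
  assumes "powers_within K q N" "k \<le> Suc N"
  shows "real k / K \<le> qint q k" "qint q k \<le> K * real k"
proof -
  have "(\<Sum>i<k. 1 / K) \<le> qint q k" "qint q k \<le> (\<Sum>i<k. K)"
    unfolding qint_def by (intro sum_mono powers_withinD[OF assms(1)]; use assms(2) in simp)+
  then show "real k / K \<le> qint q k" "qint q k \<le> K * real k" by (simp_all add: mult.commute)
qed

lemma profile_denom_ge:
  assumes "powers_within K q N" "t + m \<le> Suc N" "t \<le> N" "k \<le> N"
  shows "real (t + m) / K\<^sup>2 \<le> profile_denom q t m k"
proof -
  note K = powers_within_pos[OF assms(1)]
  have "1 / K * (real t / K) + 1 / K * (real m / K) \<le> profile_denom q t m k"
    unfolding profile_denom_def using assms K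
    by (intro add_mono mult_mono powers_withinD qint_bounds) (auto simp: powers_within_def)
  then show ?thesis by (simp add: power2_eq_square add_divide_distrib)
qed

lemma profile_jump_le:
  assumes "powers_within K q N" "t + m \<le> N" "0 < m" "k < N"
  shows "0 \<le> profile q t m (Suc k) - profile q t m k"
    and "profile q t m (Suc k) - profile q t m k \<le> K ^ 7 / real (t + m)"
proof -
  note K = powers_within_pos[OF assms(1)]
  let ?n = "real (t + m)"
  have n: "?n > 0" using assms by simp
  have d: "?n / K\<^sup>2 \<le> profile_denom q t m k" "?n / K\<^sup>2 \<le> profile_denom q t m (Suc k)"
    by (intro profile_denom_ge[OF assms(1)]; use assms in simp)+
  have d0: "profile_denom q t m k > 0" "profile_denom q t m (Suc k) > 0"
    using K assms by (auto intro!: profile_denom_pos)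
  show "0 \<le> profile q t m (Suc k) - profile q t m k"
    unfolding profile_diff_value[OF K(1) assms(3)] using d0 K qint_nonneg[OF K(1)] by simp
  have "profile q t m (Suc k) - profile q t m k \<le> K * K * (K * ?n) / (?n / K\<^sup>2 * (?n / K\<^sup>2))"
    unfolding profile_diff_value[OF K(1) assms(3)]
  proof (intro frac_le mult_mono d mult_nonneg_nonneg qint_nonneg mult_pos_pos K)
    show "q ^ t \<le> K" "q ^ k \<le> K" "qint q (t + m) \<le> K * ?n"
      by (intro powers_withinD(2)[OF assms(1)] qint_bounds(2)[OF assms(1)]; use assms in simp)+
  qed (use K n d0 in simp_all)
  also have "\<dots> = K ^ 7 / ?n" using n K by (simp add: divide_simps del: of_nat_add) algebra
  finally show "profile q t m (Suc k) - profile q t m k \<le> K ^ 7 / real (t + m)" .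
qed

lemma profile_one_step_defect_bound:
  assumes K: "powers_within K q N" and n: "n = t + m" "n < N" and m: "0 < m" and k: "k \<le> n"
  defines "p \<equiv> qint q (Suc k) / qint q (Suc n)"
  shows "\<bar>p * profile q t m k + (1 - p) * profile q t m (Suc k) - profile q (Suc t) m (Suc k)\<bar>
    \<le> K ^ 15 * \<bar>1 - q\<bar> * (real m / (real n * real (Suc n)))"
proof -
  note q = powers_within_pos[OF K]
  obtain j where j: "t + m = k + j" using k n le_Suc_ex by metis
  let ?n = "real n" and ?N = "real (Suc n)"
  have pos: "0 < ?n" "0 < ?N" using m n by auto
  have d: "?n / K\<^sup>2 \<le> profile_denom q t m k" "?n / K\<^sup>2 \<le> profile_denom q t m (Suc k)"
    "?N / K\<^sup>2 \<le> profile_denom q (Suc t) m (Suc k)" "?N / K \<le> qint q (Suc n)"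
    using n k profile_denom_ge[OF K, of t m k] profile_denom_ge[OF K, of t m "Suc k"]
      profile_denom_ge[OF K, of "Suc t" m "Suc k"] qint_bounds(1)[OF K, of "Suc n"]
    by (simp_all del: of_nat_add of_nat_Suc)
  have d0: "0 < ?n / K\<^sup>2" "0 < ?N / K\<^sup>2" "0 < ?N / K" using pos q by auto
  have dpos: "0 < profile_denom q t m k" "0 < profile_denom q t m (Suc k)"
    "0 < profile_denom q (Suc t) m (Suc k)" "0 < qint q (Suc n)"
    using d d0 by linarith+
  have num: "qint q m * (q ^ t * q ^ t * q ^ k * q ^ k * q) * qint q (Suc k) * qint q j
      \<le> (K * real m) * (K * K * K * K * K) * (K * ?N) * (K * ?n)"
  proof (intro mult_mono mult_nonneg_nonneg qint_nonneg q)
    show "qint q (Suc k) \<le> K * ?N"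
      using n k q by (intro order_trans[OF qint_bounds(2)[OF K, of "Suc k"]] mult_left_mono) auto
    show "qint q j \<le> K * ?n"
      using n k q j by (intro order_trans[OF qint_bounds(2)[OF K, of j]] mult_left_mono) auto
    show "qint q m \<le> K * real m" using n by (intro qint_bounds(2)[OF K]) auto
    show "q \<le> K" using powers_withinD(2)[OF K, of 1] n m by simp
    show "q ^ t \<le> K" "q ^ t \<le> K" "q ^ k \<le> K" "q ^ k \<le> K"
      using n k by (auto intro!: powers_withinD(2)[OF K])
  qed (use q in simp_all)
  have collect: "(K * x) * (K * K * K * K * K) * (K * z) * (K * y) /
      ((y / K\<^sup>2) * (y / K\<^sup>2) * (z / K\<^sup>2) * (z / K)) = K ^ 15 * (x / (y * z))"
    if "0 < y" "0 < z" for x y z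
    using q that by (simp add: divide_simps) algebra
  have "\<bar>p * profile q t m k + (1 - p) * profile q t m (Suc k) - profile q (Suc t) m (Suc k)\<bar> =
    \<bar>1 - q\<bar> * (qint q m * (q ^ t * q ^ t * q ^ k * q ^ k * q) * qint q (Suc k) * qint q j /
      (profile_denom q t m k * profile_denom q t m (Suc k) * profile_denom q (Suc t) m (Suc k)
         * qint q (Suc n)))"
    unfolding p_def n(1) profile_one_step_defect[OF q(1) m j]
    using q(1) dpos qint_nonneg[OF q(1)]
    by (simp add: abs_mult abs_divide abs_of_pos abs_of_nonneg n(1))
  also have "\<dots> \<le> \<bar>1 - q\<bar> * ((K * real m) * (K * K * K * K * K) * (K * ?N) * (K * ?n) /
      ((?n / K\<^sup>2) * (?n / K\<^sup>2) * (?N / K\<^sup>2) * (?N / K)))"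
  proof (intro mult_left_mono frac_le num)
    show "?n / K\<^sup>2 * (?n / K\<^sup>2) * (?N / K\<^sup>2) * (?N / K) \<le> profile_denom q t m k *
        profile_denom q t m (Suc k) * profile_denom q (Suc t) m (Suc k) * qint q (Suc n)"
      by (intro mult_mono d mult_nonneg_nonneg less_imp_le[OF dpos(1)] less_imp_le[OF dpos(2)]
          less_imp_le[OF dpos(3)] less_imp_le[OF d0(1)] less_imp_le[OF d0(2)] less_imp_le[OF d0(3)])
    show "0 < ?n / K\<^sup>2 * (?n / K\<^sup>2) * (?N / K\<^sup>2) * (?N / K)"
      by (intro mult_pos_pos d0)
    show "0 \<le> K * real m * (K * K * K * K * K) * (K * ?N) * (K * ?n)"
      using q by simp
  qed simp
  also have "(K * real m) * (K * K * K * K * K) * (K * ?N) * (K * ?n) /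
      ((?n / K\<^sup>2) * (?n / K\<^sup>2) * (?N / K\<^sup>2) * (?N / K)) = K ^ 15 * (real m / (?n * ?N))"
    by (rule collect[OF pos])
  finally show ?thesis by (simp add: mult_ac)
qed

text \<open>
  The recursion averages, so errors do not grow, and the one-step errors are at most a constant times
  \<open>\<bar>1 - q\<bar>\<close> times \<open>m / (n (n + 1)) = m / n - m / (n + 1)\<close>.  The factor \<open>1 - m / n\<close> records
  their telescoping sum, which starts at \<open>n = m\<close>.
\<close>

lemma mallows_cdf_near_profile:
  assumes K: "powers_within K q N" and "t + m \<le> N" "0 < m" "k \<le> t + m"
  shows "\<bar>mallows_cdf q (t + m) (Suc t) k - profile q t m k\<bar>
    \<le> K ^ 15 * \<bar>1 - q\<bar> * (1 - real m / real (t + m))"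
  using assms(2-)
proof (induction t arbitrary: k)
  case 0
  note q = powers_within_pos[OF K]
  obtain m' where m': "m = Suc m'" using 0 by (cases m) auto
  have "mallows_cdf q m (Suc 0) k = qint q k / qint q m"
    unfolding m' mallows_cdf_first[OF q(1)] using 0 m' by (intro sum_first_value_prob_le) auto
  then show ?case using 0 by (simp add: profile_first[OF q(1)])
next
  case (Suc t)
  note q = powers_within_pos[OF K]
  define n where "n = t + m"
  define c where "c = K ^ 15 * \<bar>1 - q\<bar>"
  have n: "Suc t + m = Suc n" "0 < n" "n < N" "m \<le> n" using Suc.prems by (auto simp: n_def)
  have c: "c \<ge> 0" using q by (simp add: c_def)
  have goal0: "0 \<le> c * (1 - real m / real (Suc n))" using c n by (intro mult_nonneg_nonneg) auto
  consider "k = 0" | "k = Suc n" | k' where "k = Suc k'" "k' < n"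
    using Suc.prems n by (cases k) force+
  then show ?case
  proof cases
    case 1
    have "mallows_cdf q (Suc n) (Suc (Suc t)) 0 = 0"
      using Suc.prems by (intro mallows_cdf_0) (auto simp: n_def)
    then show ?thesis using goal0 unfolding n(1) c_def 1 by (simp del: of_nat_Suc)
  next
    case 2
    have "mallows_cdf q (Suc n) (Suc (Suc t)) (Suc n) = 1"
      using Suc.prems by (intro mallows_cdf_top q) (auto simp: n_def)
    moreover have "profile q (Suc t) m (Suc n) = 1"
      using profile_top[OF q(1) Suc.prems(2), of "Suc t"] n(1) by simp
    ultimately show ?thesis using goal0 unfolding n(1) c_def 2 by (simp del: of_nat_Suc)
  next
    case 3
    let ?A = "mallows_cdf q n (Suc t)" and ?F = "profile q t m"
    define p where "p = qint q (Suc k') / qint q (Suc n)"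
    have p: "0 \<le> p" "p \<le> 1"
    proof -
      have "qint q (Suc k') \<le> qint q (Suc n)"
        unfolding qint_def using 3 q by (intro sum_mono2) auto
      then show "0 \<le> p" "p \<le> 1" unfolding p_def using qint_pos[OF q(1), of "Suc n"] qint_nonneg[OF q(1)]
        by auto
    qed
    have "mallows_cdf q (Suc n) (Suc (Suc t)) k = p * ?A k' + (1 - p) * ?A (Suc k')"
      unfolding p_def 3
      by (subst mallows_cdf_later, use Suc.prems n_def in simp, use Suc.prems n_def in simp,
          subst sum_first_value_prob_threshold) (use q 3 in auto)
    then have "\<bar>mallows_cdf q (Suc n) (Suc (Suc t)) k - profile q (Suc t) m k\<bar> =
      \<bar>p * (?A k' - ?F k') + (1 - p) * (?A (Suc k') - ?F (Suc k'))
        + (p * ?F k' + (1 - p) * ?F (Suc k') - profile q (Suc t) m (Suc k'))\<bar>"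
      unfolding 3 by (simp add: algebra_simps)
    also have "\<dots> \<le> p * (c * (1 - real m / real n)) + (1 - p) * (c * (1 - real m / real n))
        + c * (real m / (real n * real (Suc n)))"
    proof (intro order_trans[OF abs_triangle_ineq] add_mono)
      show "\<bar>p * (?A k' - ?F k')\<bar> \<le> p * (c * (1 - real m / real n))"
        unfolding abs_mult abs_of_nonneg[OF p(1)] c_def n_def
        using Suc.prems 3 p by (intro mult_left_mono Suc.IH) (auto simp: n_def)
      show "\<bar>(1 - p) * (?A (Suc k') - ?F (Suc k'))\<bar> \<le> (1 - p) * (c * (1 - real m / real n))"
        unfolding abs_mult using p Suc.prems 3 unfolding c_def n_def
        by (simp del: of_nat_add, intro mult_left_mono Suc.IH) (auto simp: n_def)
      show "\<bar>p * ?F k' + (1 - p) * ?F (Suc k') - profile q (Suc t) m (Suc k')\<bar>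
          \<le> c * (real m / (real n * real (Suc n)))"
        unfolding c_def p_def using 3 n Suc.prems by (intro profile_one_step_defect_bound[OF K n_def]) auto
    qed
    also have "\<dots> = c * (1 - real m / real (Suc n))"
      using n(2) by (simp add: divide_simps) algebra
    finally show ?thesis unfolding n(1) c_def .
  qed
qed

text \<open>
  A bound of order \<open>1 / n\<close> for the probability that position \<open>i\<close> has value \<open>k\<close>, when \<open>1 - q\<close> is of order \<open>1 / N\<close>.
\<close>

lemma mallows_cdf_jump_le:
  assumes K: "powers_within K q N" and "n \<le> N" "1 \<le> i" "i \<le> n"
  shows "\<bar>mallows_cdf q n i (k - 1) - mallows_cdf q n i k\<bar> \<le> K ^ 7 / real n + 2 * K ^ 15 * \<bar>1 - q\<bar>"
proof -
  note q = powers_within_pos[OF K]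
  obtain t m where i: "i = Suc t" "n = t + m" "0 < m"
    using assms(3,4) by (intro that[of "i - 1" "n - (i - 1)"]) auto
  let ?e = "K ^ 15 * \<bar>1 - q\<bar>"
  have e: "?e \<ge> 0" using q by simp
  have rhs: "0 \<le> K ^ 7 / real n" using q by simp
  consider "k = 0" | "n < k" | k' where "k = Suc k'" "k' < n"
    by (cases k) force+
  then show ?thesis
  proof cases
    case 1 then show ?thesis using e rhs by simp
  next
    case 2
    then have "mallows_cdf q n i (k - 1) = 1" "mallows_cdf q n i k = 1"
      using assms by (auto intro!: mallows_cdf_top q)
    then show ?thesis using e rhs by simp
  next
    case 3
    have near: "\<bar>mallows_cdf q n i c - profile q t m c\<bar> \<le> ?e" if "c \<le> n" for c
    proof -
      have "\<bar>mallows_cdf q n i c - profile q t m c\<bar> \<le> ?e * (1 - real m / real (t + m))"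
        unfolding i using that assms i by (intro mallows_cdf_near_profile[OF K]) auto
      also have "\<dots> \<le> ?e * 1" using e by (intro mult_left_mono) auto
      finally show ?thesis by simp
    qed
    have "\<bar>profile q t m k' - profile q t m k\<bar> \<le> K ^ 7 / real n"
      using profile_jump_le[OF K, of t m k'] assms i 3 by auto
    then show ?thesis using near[of k'] near[of k] 3 by simp
  qed
qed

text \<open>
  When \<open>1 - q\<close> has order \<open>1 / N\<close>, so has \<open>J\<close>, and therefore the bound.  If the smaller of
  the two positions lies in the left half, the recursion reaches it before more than half of the
  points are removed, and otherwise reversal leads to this case.
\<close>

lemma mallows_cov_at_most_bound:
  assumes K: "powers_within K q N" and N: "2 \<le> N"
    and i: "i \<in> {1..N}" and j: "j \<in> {1..N}" and "i \<noteq> j" and k: "k \<le> N" "l \<le> N"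
  defines "J \<equiv> 4 * K ^ 7 / real N + 2 * K ^ 15 * \<bar>1 - q\<bar>"
  shows "\<bar>mallows_cov N q (at_most i k) (at_most j l)\<bar> \<le> 2 * J + real N * (2 * J * J)"
proof -
  note q = powers_within_pos[OF K]
  have J: "0 \<le> J" unfolding J_def using q by simp
  \<comment> \<open>Sizes \<open>n \<ge> N div 2\<close> satisfy \<open>N \<le> 4 n\<close>, hence the factor \<open>4\<close> in \<open>J\<close>.\<close>
  have jump: "\<bar>mallows_cdf q n a (c - 1) - mallows_cdf q n a c\<bar> \<le> J"
    if n: "N div 2 \<le> n" "n \<le> N" and a: "1 \<le> a" "a \<le> n" for n a c
  proof -
    have "real N \<le> 4 * real n" "0 < real n" "0 < real N" using n N by linarith+
    then have "K ^ 7 / real n \<le> 4 * K ^ 7 / real N" using q by (simp add: divide_simps)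
    then show ?thesis using mallows_cdf_jump_le[OF K n(2) a, of c] unfolding J_def by linarith
  qed
  have left: "\<bar>mallows_cov N q (at_most a c) (at_most b d)\<bar> \<le> 2 * J + real N * (2 * J * J)"
    if "1 \<le> a" "a < b" "b \<le> N" "2 * a \<le> N" for a b c d
  proof -
    have "\<bar>mallows_cov N q (at_most a c) (at_most b d)\<bar> \<le> 2 * J + real (a - 1) * (2 * J * J)"
      by (rule abs_mallows_cov_at_most_le[where M = "N div 2" and N = N, OF q(1) jump]) (use that in auto)
    also have "\<dots> \<le> 2 * J + real N * (2 * J * J)"
      using that J by (intro add_left_mono mult_right_mono) auto
    finally show ?thesis .
  qed
  have ordered: "\<bar>mallows_cov N q (at_most a c) (at_most b d)\<bar> \<le> 2 * J + real N * (2 * J * J)"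
    if "a < b" "a \<in> {1..N}" "b \<in> {1..N}" "c \<le> N" "d \<le> N" for a b c d
  proof (cases "2 * a \<le> N")
    case True
    then show ?thesis using left that by auto
  next
    case False
    then show ?thesis
      unfolding mallows_cov_reflect[OF q(1) that(2-5)] mallows_cov_commute[of N q "at_most (N + 1 - a) _"]
      using that by (intro left) auto
  qed
  show ?thesis
  proof (cases "i < j")
    case True then show ?thesis using ordered i j k by blast
  next
    case False
    then show ?thesis using ordered[of j i] i j k \<open>i \<noteq> j\<close> by (subst mallows_cov_commute) auto
  qed
qed

section \<open>The limiting distribution function and its density\<close>

text \<open>
  Extended continuously to \<open>0\<close>.  This function allows the cases \<open>\<beta> = 0\<close> and \<open>\<beta> \<noteq> 0\<close>
  to be treated together.
\<close>

definition exp_quotient :: "real \<Rightarrow> real" where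
  "exp_quotient z = (if z = 0 then 1 else (1 - exp (- z)) / z)"

lemma exp_quotient_pos: "exp_quotient z > 0"
proof -
  consider "z > 0" | "z = 0" | "z < 0" by linarith
  then show ?thesis by cases (auto simp: exp_quotient_def divide_neg_neg)
qed

lemma isCont_exp_quotient: "isCont exp_quotient z"
proof (cases "z = 0")
  case False
  have "isCont (\<lambda>z. (1 - exp (- z)) / z) z" using False by (intro continuous_intros) auto
  moreover have "\<forall>\<^sub>F y in nhds z. exp_quotient y = (1 - exp (- y)) / y"
    using t1_space_nhds[OF False] by eventually_elim (simp add: exp_quotient_def)
  ultimately show ?thesis by (simp add: isCont_cong)
next
  case True
  have "((\<lambda>z. 1 - exp (- z)) has_real_derivative 1) (at 0)"
    by (auto intro!: derivative_eq_intros)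
  then have "((\<lambda>z. (1 - exp (- z)) / z) \<longlongrightarrow> 1) (at (0::real))"
    by (simp add: DERIV_def)
  then have "(exp_quotient \<longlongrightarrow> 1) (at 0)"
    by (rule Lim_transform_eventually) (auto simp: exp_quotient_def eventually_at_filter)
  then show ?thesis by (simp add: True isCont_def exp_quotient_def)
qed

text \<open>
  The integral of \<open>s \<mapsto> exp (- b s)\<close> over \<open>[0, x]\<close>, the continuous analogue of a Gaussian integer.
\<close>

definition exp_integral :: "real \<Rightarrow> real \<Rightarrow> real" where
  "exp_integral b x = x * exp_quotient (b * x)"

lemma exp_integral_0 [simp]: "exp_integral b 0 = 0"
  by (simp add: exp_integral_def)

lemma exp_integral_zero_rate [simp]: "exp_integral 0 x = x"
  by (simp add: exp_integral_def exp_quotient_def)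

lemma exp_integral_nonneg: "x \<ge> 0 \<Longrightarrow> exp_integral b x \<ge> 0"
  by (simp add: exp_integral_def less_imp_le[OF exp_quotient_pos])

lemma exp_integral_pos: "x > 0 \<Longrightarrow> exp_integral b x > 0"
  by (simp add: exp_integral_def exp_quotient_pos)

lemma exp_integral_nonzero_rate: "b \<noteq> 0 \<Longrightarrow> exp_integral b x = (1 - exp (- (b * x))) / b"
  by (simp add: exp_integral_def exp_quotient_def)

lemma exp_integral_add: "exp_integral b (x + y) = exp_integral b x + exp (- (b * x)) * exp_integral b y"
proof (cases "b = 0")
  case False
  have "exp (- (b * (x + y))) = exp (- (b * x)) * exp (- (b * y))"
    by (simp add: distrib_left flip: exp_add)
  then show ?thesis using False by (simp add: exp_integral_nonzero_rate divide_simps algebra_simps)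
qed simp

definition limit_denom :: "real \<Rightarrow> real \<Rightarrow> real \<Rightarrow> real" where
  "limit_denom b x y = exp (- (b * y)) * exp_integral b x + exp (- (b * x)) * exp_integral b (1 - x)"

text \<open>
  The formula of \<open>profile\<close> with \<open>exp_integral\<close> in the place of Gaussian integers.
\<close>

definition limit_cdf :: "real \<Rightarrow> real \<Rightarrow> real \<Rightarrow> real" where
  "limit_cdf b x y = exp (- (b * x)) * exp_integral b y / limit_denom b x y"

lemma limit_denom_pos:
  assumes "x \<in> {0..1}"
  shows "limit_denom b x y > 0"
proof (cases "x = 1")
  case True
  then show ?thesis by (simp add: limit_denom_def exp_integral_pos)
next
  case False
  then show ?thesis unfolding limit_denom_def using assms
    by (intro add_nonneg_pos mult_nonneg_nonneg mult_pos_pos exp_integral_nonneg exp_integral_pos) auto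
qed

lemma limit_cdf_0 [simp]: "limit_cdf b x 0 = 0"
  by (simp add: limit_cdf_def)

lemma limit_cdf_1:
  assumes "x \<in> {0..1}"
  shows "limit_cdf b x 1 = 1"
proof -
  have "exp_integral b 1 = exp_integral b (1 - x) + exp (- (b * (1 - x))) * exp_integral b x"
    using exp_integral_add[of b "1 - x" x] by simp
  moreover have "exp (- (b * x)) * exp (- (b * (1 - x))) = exp (- (b * 1))"
    by (simp add: algebra_simps flip: exp_add)
  ultimately have "exp (- (b * x)) * exp_integral b 1 = limit_denom b x 1"
    by (simp add: limit_denom_def distrib_left mult.assoc[symmetric] del: mult.assoc)
  then show ?thesis using limit_denom_pos[OF assms, of b 1] by (simp add: limit_cdf_def)
qed

lemma continuous_on_exp_integral [continuous_intros]:
  assumes "continuous_on S f" "continuous_on S g"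
  shows "continuous_on S (\<lambda>z. exp_integral (f z) (g z))"
proof -
  have "continuous_on UNIV exp_quotient" by (simp add: continuous_at_imp_continuous_on isCont_exp_quotient)
  then have "continuous_on S (\<lambda>z. exp_quotient (f z * g z))"
    by (rule continuous_on_compose2) (use assms in \<open>auto intro: continuous_on_mult\<close>)
  then show ?thesis unfolding exp_integral_def by (rule continuous_on_mult[OF assms(2)])
qed

lemma continuous_on_limit_cdf:
  "continuous_on (B \<times> {0..1} \<times> Y) (\<lambda>(b, x, y). limit_cdf b x y)"
proof -
  have "limit_denom (fst z) (fst (snd z)) (snd (snd z)) \<noteq> 0" if "z \<in> B \<times> {0..1} \<times> Y" for z
    using limit_denom_pos[of "fst (snd z)" "fst z" "snd (snd z)"] that by auto
  then show ?thesis
    unfolding case_prod_unfold limit_cdf_def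
    by (intro continuous_on_divide) (auto simp: limit_denom_def intro!: continuous_intros)
qed

text \<open>
  With \<open>b = - n ln q\<close>, the power \<open>q\<^sup>j\<close> is \<open>exp (- b j / n)\<close>, and \<open>[j]\<close> is \<open>exp_integral b (j / n)\<close> up
  to a constant factor, which cancels.  So passing to the limit only needs continuity of
  \<open>limit_cdf\<close>.
\<close>

lemma profile_eq_limit_cdf:
  assumes q: "q > 0" and n: "n = t + m" "n > 0"
  shows "profile q t m k = limit_cdf (- real n * ln q) (real t / real n) (real k / real n)"
proof -
  define b where "b = - real n * ln q"
  define c where "c = (if q = 1 then real n else b / (1 - q))"
  have b: "b = 0 \<longleftrightarrow> q = 1" using q n(2) by (simp add: b_def)
  have c: "c \<noteq> 0" using b n by (auto simp: c_def)
  have pow: "q ^ j = exp (- (b * (real j / real n)))" for j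
    using q n(2) by (simp add: b_def exp_of_nat2_mult)
  have qint: "qint q j = c * exp_integral b (real j / real n)" for j
  proof (cases "q = 1")
    case True
    then show ?thesis using b n(2) by (simp add: c_def qint_def)
  next
    case False
    then have "qint q j = (1 - q ^ j) / (1 - q)"
      using one_minus_times_qint[of q j] by (simp add: field_simps)
    then show ?thesis using b False unfolding pow by (simp add: c_def exp_integral_nonzero_rate)
  qed
  have m: "real m / real n = 1 - real t / real n"
    using n(2) by (simp add: n(1) divide_simps del: of_nat_add)
  show ?thesis
    unfolding b_def[symmetric] profile_def profile_denom_def limit_cdf_def limit_denom_def qint pow m
    using c by (simp add: mult.left_commute[of _ c] flip: distrib_left)
qed

lemma mallows_density_nonneg: "mallows_density x y \<beta> \<ge> 0"
proof -
  have "\<beta> / 2 * sinh (\<beta> / 2) \<ge> 0"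
    by (cases "\<beta> \<ge> 0") (auto simp: zero_le_mult_iff)
  then show ?thesis by (simp add: mallows_density_def)
qed

text \<open>
  Writing the hyperbolic cosines as exponentials identifies the expression that is squared in
  the density with the denominator of the distribution function.
\<close>

lemma mallows_density_denominator:
  assumes "\<beta> \<noteq> 0"
  shows "\<beta> * limit_denom \<beta> x y = 2 * exp (- \<beta> / 4) * exp (- (\<beta> * (x + y) / 2)) *
     (exp (\<beta> / 4) * cosh (\<beta> * (x - y) / 2) - exp (- \<beta> / 4) * cosh (\<beta> * (x + y - 1) / 2))"
proof -
  have "\<beta> * limit_denom \<beta> x y = exp (- (\<beta> * y)) * (1 - exp (- (\<beta> * x)))
      + exp (- (\<beta> * x)) * (1 - exp (- (\<beta> * (1 - x))))"
    unfolding limit_denom_def exp_integral_nonzero_rate[OF assms] distrib_left using assms by simp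
  also have "\<dots> = exp (- (\<beta> * y)) + exp (- (\<beta> * x)) - exp (- \<beta>) - exp (- (\<beta> * (x + y)))"
    unfolding right_diff_distrib exp_add[symmetric] by (simp add: algebra_simps)
  also have "\<dots> = 2 * exp (- \<beta> / 4) * exp (- (\<beta> * (x + y) / 2)) *
     (exp (\<beta> / 4) * cosh (\<beta> * (x - y) / 2) - exp (- \<beta> / 4) * cosh (\<beta> * (x + y - 1) / 2))"
    unfolding cosh_field_def right_diff_distrib distrib_left add_divide_distrib
    by (simp add: mult.assoc[symmetric] exp_add[symmetric]) (simp add: algebra_simps add_divide_distrib diff_divide_distrib)
  finally show ?thesis .
qed

lemma mallows_density_eq:
  assumes "\<beta> \<noteq> 0"
  shows "mallows_density x y \<beta> =
    \<beta> * (1 - exp (- \<beta>)) * exp (- (\<beta> * (x + y))) / (\<beta> * limit_denom \<beta> x y)\<^sup>2"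
proof -
  define d where "d = exp (\<beta> / 4) * cosh (\<beta> * (x - y) / 2) - exp (- \<beta> / 4) * cosh (\<beta> * (x + y - 1) / 2)"
  have sq: "(2 * exp (- \<beta> / 4) * exp (- (\<beta> * (x + y) / 2)))\<^sup>2 = 4 * (exp (- \<beta> / 2) * exp (- (\<beta> * (x + y))))"
  proof -
    have "(exp (- \<beta> / 4))\<^sup>2 = exp (- \<beta> / 2)" "(exp (- (\<beta> * (x + y) / 2)))\<^sup>2 = exp (- (\<beta> * (x + y)))"
      by (simp_all flip: exp_double)
    then show ?thesis by (simp add: power_mult_distrib)
  qed
  have "2 * exp (- \<beta> / 2) * sinh (\<beta> / 2) = 1 - exp (- \<beta>)"
  proof -
    have "exp (- \<beta>) = exp (- \<beta> / 2) * exp (- \<beta> / 2)" "exp (- \<beta> / 2) * exp (\<beta> / 2) = 1"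
      by (simp_all flip: exp_add)
    then show ?thesis by (simp add: sinh_field_def right_diff_distrib)
  qed
  then have "\<beta> * (1 - exp (- \<beta>)) * exp (- (\<beta> * (x + y))) / (\<beta> * limit_denom \<beta> x y)\<^sup>2
    = \<beta> * (2 * exp (- \<beta> / 2) * sinh (\<beta> / 2)) * exp (- (\<beta> * (x + y)))
       / (4 * (exp (- \<beta> / 2) * exp (- (\<beta> * (x + y)))) * d\<^sup>2)"
    unfolding mallows_density_denominator[OF assms] d_def[symmetric] power_mult_distrib[of _ d] sq by simp
  also have "\<dots> = (\<beta> / 2) * sinh (\<beta> / 2) / d\<^sup>2" by (simp add: divide_simps)
  finally show ?thesis using assms by (simp add: mallows_density_def d_def)
qed

lemma limit_cdf_has_derivative:
  assumes "x \<in> {0..1}"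
  shows "(limit_cdf \<beta> x has_real_derivative mallows_density x y \<beta>) (at y)"
proof (cases "\<beta> = 0")
  case True
  have "limit_cdf 0 x = (\<lambda>y. y)" by (simp add: fun_eq_iff limit_cdf_def limit_denom_def)
  then show ?thesis using True by (simp add: mallows_density_def)
next
  case False
  define a where "a = exp (- (\<beta> * x))"
  have D: "limit_denom \<beta> x = (\<lambda>y. (exp (- (\<beta> * y)) * (1 - a) + a - exp (- \<beta>)) / \<beta>)"
  proof
    fix z
    have "a * exp (- (\<beta> * (1 - x))) = exp (- \<beta>)"
      unfolding a_def exp_add[symmetric] by (simp add: algebra_simps)
    then show "limit_denom \<beta> x z = (exp (- (\<beta> * z)) * (1 - a) + a - exp (- \<beta>)) / \<beta>"
      unfolding limit_denom_def exp_integral_nonzero_rate[OF False] a_def[symmetric]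
      by (simp add: right_diff_distrib diff_divide_distrib add_divide_distrib)
  qed
  have pos: "exp (- (\<beta> * y)) * (1 - a) + a - exp (- \<beta>) \<noteq> 0"
    using limit_denom_pos[OF assms, of \<beta> y] False unfolding D by auto
  have eq: "limit_cdf \<beta> x = (\<lambda>y. a * (1 - exp (- (\<beta> * y))) / (exp (- (\<beta> * y)) * (1 - a) + a - exp (- \<beta>)))"
    unfolding limit_cdf_def D exp_integral_nonzero_rate[OF False] a_def using False by (simp add: fun_eq_iff)
  have dens: "mallows_density x y \<beta> =
     \<beta> * (1 - exp (- \<beta>)) * (a * exp (- (\<beta> * y))) / (exp (- (\<beta> * y)) * (1 - a) + a - exp (- \<beta>))\<^sup>2"
    unfolding mallows_density_eq[OF False] D a_def using False
    by (simp add: distrib_left flip: exp_add)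
  show ?thesis unfolding eq dens
    by (rule derivative_eq_intros refl pos)+ (simp add: power2_eq_square algebra_simps)
qed

lemma continuous_on_mallows_density:
  assumes "x \<in> {0..1}"
  shows "continuous_on S (\<lambda>y. mallows_density x y \<beta>)"
proof (cases "\<beta> = 0")
  case True
  then show ?thesis by (simp add: mallows_density_def)
next
  case False
  then show ?thesis
    unfolding mallows_density_eq[OF False] limit_denom_def
    using limit_denom_pos[OF assms, of \<beta>] False
    by (intro continuous_intros) (auto simp: limit_denom_def less_le)
qed

lemma mallows_density_has_integral:
  assumes "x \<in> {0..1}" "a \<le> b"
  shows "((\<lambda>y. mallows_density x y \<beta>) has_integral (limit_cdf \<beta> x b - limit_cdf \<beta> x a)) {a..b}"
  using limit_cdf_has_derivative[OF assms(1)] assms(2)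
  by (intro fundamental_theorem_of_calculus)
    (auto simp: has_real_derivative_iff_has_vector_derivative[symmetric] intro: has_field_derivative_at_within)

section \<open>Integrals against a density as sums over a grid\<close>

text \<open>
  On a cell of length \<open>1 / n\<close> the function \<open>f\<close> differs from its value at the right end by at most
  \<open>L / n\<close>, and \<open>u\<close> integrates to the increment of \<open>U\<close>.
\<close>

lemma stieltjes_sum_bound:
  fixes f u U :: "real \<Rightarrow> real"
  assumes n: "n > 0" and L: "L-lipschitz_on {0..1} f"
    and u: "continuous_on {0..1} u" "\<And>y. y \<in> {0..1} \<Longrightarrow> u y \<ge> 0"
    and U: "\<And>a b. 0 \<le> a \<Longrightarrow> a \<le> b \<Longrightarrow> b \<le> 1 \<Longrightarrow> (u has_integral (U b - U a)) {a..b}"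
    and "k \<le> n"
  shows "\<bar>integral {0..real k / real n} (\<lambda>y. f y * u y)
      - (\<Sum>r<k. f (real (Suc r) / real n) * (U (real (Suc r) / real n) - U (real r / real n)))\<bar>
    \<le> L / real n * (U (real k / real n) - U 0)"
  using \<open>k \<le> n\<close>
proof (induction k)
  case 0
  then show ?case by simp
next
  case (Suc k)
  define a where "a = real k / real n"
  define b where "b = real (Suc k) / real n"
  have ab: "0 \<le> a" "a \<le> b" "b \<le> 1" "b - a = 1 / real n"
    using n Suc.prems by (auto simp: a_def b_def field_simps)
  have f: "continuous_on {0..1} f" by (rule lipschitz_on_continuous_on[OF L])
  have cont: "continuous_on {c..d} (\<lambda>y. f y * u y)" "continuous_on {c..d} u"
    if "0 \<le> c" "d \<le> 1" for c d
    using that by (auto intro!: continuous_on_mult intro: continuous_on_subset[OF f] continuous_on_subset[OF u(1)])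
  have int: "(\<lambda>y. f y * u y) integrable_on {c..d}" "u integrable_on {c..d}" if "0 \<le> c" "d \<le> 1" for c d
    using cont[OF that] by (auto intro: integrable_continuous_real)
  have Uab: "integral {a..b} u = U b - U a" using U[OF ab(1-3)] by (rule integral_unique)
  have "norm (integral {a..b} (\<lambda>y. f y * u y - f b * u y)) \<le> integral {a..b} (\<lambda>y. L / real n * u y)"
  proof (rule integral_norm_bound_integral)
    show "(\<lambda>y. f y * u y - f b * u y) integrable_on {a..b}"
      "(\<lambda>y. L / real n * u y) integrable_on {a..b}"
      using int[OF ab(1,3)] by (intro integrable_diff integrable_on_mult_right; blast)+
    show "norm (f y * u y - f b * u y) \<le> L / real n * u y" if y: "y \<in> {a..b}" for y
    proof -
      have "norm (f y - f b) \<le> L * norm (y - b)"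
        using y ab by (intro lipschitz_on_normD[OF L]) auto
      also have "\<dots> \<le> L * (1 / real n)"
        using y ab lipschitz_on_nonneg[OF L] by (intro mult_left_mono) auto
      finally have "\<bar>f y - f b\<bar> * u y \<le> L / real n * u y"
        using u(2)[of y] y ab by (intro mult_right_mono) auto
      then show ?thesis using u(2)[of y] y ab by (simp add: abs_mult flip: left_diff_distrib)
    qed
  qed
  also have "integral {a..b} (\<lambda>y. f y * u y - f b * u y) = integral {a..b} (\<lambda>y. f y * u y) - f b * (U b - U a)"
    using int[OF ab(1,3)] by (subst integral_diff) (auto simp: Uab intro!: integrable_on_mult_right)
  also have "integral {a..b} (\<lambda>y. L / real n * u y) = L / real n * (U b - U a)"
    by (simp add: Uab)
  finally have step: "\<bar>integral {a..b} (\<lambda>y. f y * u y) - f b * (U b - U a)\<bar> \<le> L / real n * (U b - U a)"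
    by simp
  have "integral {0..b} (\<lambda>y. f y * u y) = integral {0..a} (\<lambda>y. f y * u y) + integral {a..b} (\<lambda>y. f y * u y)"
    using ab int[of 0 b] by (intro Henstock_Kurzweil_Integration.integral_combine[symmetric]) auto
  moreover have "L / real n * (U b - U 0) = L / real n * (U a - U 0) + L / real n * (U b - U a)"
    by (simp add: algebra_simps)
  ultimately show ?case
    using Suc.IH Suc.prems step unfolding a_def[symmetric] b_def[symmetric] sum.lessThan_Suc by simp
qed

lemma summation_by_parts:
  fixes f U :: "nat \<Rightarrow> real"
  assumes "U 0 = 0"
  shows "(\<Sum>r<n. f (Suc r) * (U (Suc r) - U r)) = f n * U n - (\<Sum>k<n. (f (Suc k) - f k) * U k)"
  by (induction n) (simp_all add: assms algebra_simps)

section \<open>Uniform limits of distribution functions and covariances\<close>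

text \<open>
  The parameter \<open>b\<close> with \<open>q = exp (- b / n)\<close>.
\<close>

definition inverse_temperature :: "nat \<Rightarrow> real \<Rightarrow> real" where
  "inverse_temperature n q = - real n * ln q"

text \<open>
  The inequalities \<open>1 - q \<le> - ln q \<le> (1 - q) / q\<close> squeeze \<open>- n ln q\<close> between two sequences with
  limit \<open>\<beta>\<close>.
\<close>

lemma inverse_temperature_tendsto:
  fixes q :: "nat \<Rightarrow> real"
  assumes q: "\<forall>n\<ge>1. q n > 0" and lim: "(\<lambda>n. real n * (1 - q n)) \<longlonglongrightarrow> \<beta>"
  shows "q \<longlonglongrightarrow> 1" "(\<lambda>n. inverse_temperature n (q n)) \<longlonglongrightarrow> \<beta>"
proof -
  have "(\<lambda>n. real n * (1 - q n) * (1 / real n)) \<longlonglongrightarrow> \<beta> * 0"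
    by (intro tendsto_mult lim lim_1_over_n)
  then have "(\<lambda>n. 1 - real n * (1 - q n) * (1 / real n)) \<longlonglongrightarrow> 1 - \<beta> * 0"
    by (intro tendsto_diff tendsto_const)
  then show q1: "q \<longlonglongrightarrow> 1"
    by (rule Lim_transform_eventually[THEN tendsto_eq_rhs])
      (rule eventually_mono[OF eventually_gt_at_top[of 0]], simp_all)
  have "(\<lambda>n. real n * (1 - q n) / q n) \<longlonglongrightarrow> \<beta> / 1"
    by (intro tendsto_divide lim q1) simp
  then have upper: "(\<lambda>n. real n * (1 - q n) / q n) \<longlonglongrightarrow> \<beta>" by simp
  show "(\<lambda>n. inverse_temperature n (q n)) \<longlonglongrightarrow> \<beta>"
  proof (rule real_tendsto_sandwich[OF _ _ lim upper])
    show "\<forall>\<^sub>F n in sequentially. real n * (1 - q n) \<le> inverse_temperature n (q n)"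
      using eventually_ge_at_top[of 1]
    proof eventually_elim
      case (elim n)
      have "real n * (1 - q n) \<le> real n * (- ln (q n))"
        using ln_le_minus_one[OF q[rule_format, OF elim]] by (intro mult_left_mono) auto
      then show ?case by (simp add: inverse_temperature_def)
    qed
    show "\<forall>\<^sub>F n in sequentially. inverse_temperature n (q n) \<le> real n * (1 - q n) / q n"
      using eventually_ge_at_top[of 1]
    proof eventually_elim
      case (elim n)
      have "- ln (q n) \<le> 1 / q n - 1"
        using ln_le_minus_one[of "1 / q n"] q[rule_format, OF elim] by (simp add: ln_div)
      then have "real n * (- ln (q n)) \<le> real n * (1 / q n - 1)" by (intro mult_left_mono) auto
      then show ?case using q[rule_format, OF elim] by (simp add: inverse_temperature_def field_simps)
    qed
  qed
qed

lemma powers_within_exp: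
  assumes "q > 0" "n > 0" "\<bar>inverse_temperature n q\<bar> \<le> B"
  shows "powers_within (exp B) q n"
proof -
  have "1 / exp B \<le> q ^ j \<and> q ^ j \<le> exp B" if "j \<le> n" for j
  proof -
    have "\<bar>real j * ln q\<bar> \<le> real n * \<bar>ln q\<bar>" using that by (auto simp: abs_mult intro: mult_right_mono)
    also have "\<dots> \<le> B" using assms by (simp add: inverse_temperature_def abs_mult)
    finally have "- B \<le> real j * ln q" "real j * ln q \<le> B" by linarith+
    moreover have "q ^ j = exp (real j * ln q)" using assms by (simp add: exp_of_nat_mult)
    moreover have "1 / exp B = exp (- B)" by (simp add: exp_minus field_simps)
    ultimately show ?thesis by simp
  qed
  then show ?thesis using assms by (simp add: powers_within_def)
qed

lemma eventually_powers_within: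
  fixes q :: "nat \<Rightarrow> real"
  assumes q: "\<forall>n\<ge>1. q n > 0" and lim: "(\<lambda>n. real n * (1 - q n)) \<longlonglongrightarrow> \<beta>"
  shows "\<forall>\<^sub>F n in sequentially. powers_within (exp (\<bar>\<beta>\<bar> + 1)) (q n) n"
proof -
  have "\<forall>\<^sub>F n in sequentially. dist (inverse_temperature n (q n)) \<beta> < 1"
    using inverse_temperature_tendsto(2)[OF assms] by (rule tendstoD) (rule zero_less_one)
  then show ?thesis using eventually_ge_at_top[of 1]
  proof eventually_elim
    case (elim n)
    then show ?case using q[rule_format, of n] by (intro powers_within_exp) (auto simp: dist_real_def)
  qed
qed

text \<open>
  Uniform continuity on a compact set of parameters absorbs both the change from \<open>b n\<close> to \<open>\<beta>\<close> and
  the shift from \<open>t / n\<close> to \<open>(t + 1) / n\<close>.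
\<close>

lemma limit_cdf_uniform:
  fixes b :: "nat \<Rightarrow> real"
  assumes b: "b \<longlonglongrightarrow> \<beta>" and e: "e > 0"
  shows "\<forall>\<^sub>F n in sequentially. \<forall>t<n. \<forall>k\<le>n.
    \<bar>limit_cdf (b n) (real t / real n) (real k / real n)
      - limit_cdf \<beta> (real (Suc t) / real n) (real k / real n)\<bar> < e"
proof -
  let ?S = "{\<beta> - 1..\<beta> + 1} \<times> {0..1} \<times> {0..1::real}"
  have "uniformly_continuous_on ?S (\<lambda>(b, x, y). limit_cdf b x y)"
    by (intro compact_uniformly_continuous continuous_on_limit_cdf compact_Times) auto
  then obtain d where d: "d > 0" and close: "\<And>z z'. z \<in> ?S \<Longrightarrow> z' \<in> ?S \<Longrightarrow> dist z' z < d \<Longrightarrow>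
      dist ((\<lambda>(b, x, y). limit_cdf b x y) z') ((\<lambda>(b, x, y). limit_cdf b x y) z) < e"
    unfolding uniformly_continuous_on_def using e by metis
  have "\<forall>\<^sub>F n in sequentially. dist (b n) \<beta> < min 1 (d / 2)"
    using b by (rule tendstoD) (use d in simp)
  moreover have "\<forall>\<^sub>F n in sequentially. dist (1 / real n) 0 < d / 2"
    using lim_1_over_n by (rule tendstoD) (use d in simp)
  ultimately show ?thesis using eventually_gt_at_top[of 0]
  proof eventually_elim
    case (elim n)
    show ?case
    proof (intro allI impI)
      fix t k assume tk: "t < n" "k \<le> n"
      let ?z' = "(b n, real t / real n, real k / real n)"
      let ?z = "(\<beta>, real (Suc t) / real n, real k / real n)"
      have mem: "?z \<in> ?S" "?z' \<in> ?S" using tk elim by (auto simp: dist_real_def)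
      have "dist ?z' ?z \<le> dist (b n) \<beta> + dist (real t / real n) (real (Suc t) / real n)"
        unfolding dist_Pair_Pair
        using sqrt_sum_squares_le_sum_abs[of "dist (b n) \<beta>" "dist (real t / real n) (real (Suc t) / real n)"]
        by simp
      also have "dist (real t / real n) (real (Suc t) / real n) = 1 / real n"
        using elim by (simp add: dist_real_def field_simps flip: diff_divide_distrib)
      also have "dist (b n) \<beta> + 1 / real n < d" using elim by simp
      finally show "\<bar>limit_cdf (b n) (real t / real n) (real k / real n)
        - limit_cdf \<beta> (real (Suc t) / real n) (real k / real n)\<bar> < e"
        using close[OF mem] by (simp add: dist_real_def)
    qed
  qed
qed

lemma mallows_cdf_uniform_limit:
  fixes q :: "nat \<Rightarrow> real"
  assumes q: "\<forall>n\<ge>1. q n > 0" and lim: "(\<lambda>n. real n * (1 - q n)) \<longlonglongrightarrow> \<beta>" and e: "e > 0"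
  shows "\<forall>\<^sub>F n in sequentially. \<forall>i\<in>{1..n}. \<forall>k\<le>n.
    \<bar>mallows_cdf (q n) n i k - limit_cdf \<beta> (real i / real n) (real k / real n)\<bar> < e"
proof -
  let ?K = "exp (\<bar>\<beta>\<bar> + 1)"
  have "(\<lambda>n. ?K ^ 15 * \<bar>1 - q n\<bar>) \<longlonglongrightarrow> ?K ^ 15 * \<bar>1 - 1\<bar>"
    by (intro tendsto_intros inverse_temperature_tendsto(1)[OF q lim])
  then have "\<forall>\<^sub>F n in sequentially. dist (?K ^ 15 * \<bar>1 - q n\<bar>) (?K ^ 15 * \<bar>1 - 1\<bar>) < e / 2"
    by (rule tendstoD) (use e in simp)
  moreover have "\<forall>\<^sub>F n in sequentially. \<forall>t<n. \<forall>k\<le>n.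
    \<bar>limit_cdf (inverse_temperature n (q n)) (real t / real n) (real k / real n)
      - limit_cdf \<beta> (real (Suc t) / real n) (real k / real n)\<bar> < e / 2"
    by (intro limit_cdf_uniform inverse_temperature_tendsto(2) q lim) (use e in auto)
  ultimately show ?thesis using eventually_powers_within[OF q lim] eventually_gt_at_top[of 0]
  proof eventually_elim
    case (elim n)
    note K = elim(3)
    show ?case
    proof (intro ballI allI impI)
      fix i k assume i: "i \<in> {1..n}" and k: "k \<le> n"
      obtain t m where t: "i = Suc t" "n = t + m" "0 < m" "t < n"
        using i by (intro that[of "i - 1" "n - (i - 1)"]) auto
      have "\<bar>mallows_cdf (q n) n i k - profile (q n) t m k\<bar> \<le> ?K ^ 15 * \<bar>1 - q n\<bar> * (1 - real m / real n)"
        using mallows_cdf_near_profile[OF K, of t m k] t k by simp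
      also have "\<dots> \<le> ?K ^ 15 * \<bar>1 - q n\<bar> * 1" by (intro mult_left_mono) auto
      also have "\<dots> < e / 2" using elim(1) by simp
      finally have "\<bar>mallows_cdf (q n) n i k - profile (q n) t m k\<bar> < e / 2" .
      moreover have "profile (q n) t m k =
          limit_cdf (inverse_temperature n (q n)) (real t / real n) (real k / real n)"
        unfolding inverse_temperature_def
        by (intro profile_eq_limit_cdf powers_within_pos(1)[OF K] t elim)
      ultimately show "\<bar>mallows_cdf (q n) n i k - limit_cdf \<beta> (real i / real n) (real k / real n)\<bar> < e"
        using elim(2)[rule_format, OF t(4) k] unfolding t(1) by linarith
    qed
  qed
qed

text \<open>
  In the quantitative bound \<open>2 J + 2 n J\<^sup>2\<close> the product \<open>n J\<close> stays bounded, while \<open>J\<close> tends to zero.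
\<close>

lemma mallows_cov_at_most_uniform_limit:
  fixes q :: "nat \<Rightarrow> real"
  assumes q: "\<forall>n\<ge>1. q n > 0" and lim: "(\<lambda>n. real n * (1 - q n)) \<longlonglongrightarrow> \<beta>" and e: "e > 0"
  shows "\<forall>\<^sub>F n in sequentially. \<forall>i\<in>{1..n}. \<forall>j\<in>{1..n}. i \<noteq> j \<longrightarrow> (\<forall>k\<le>n. \<forall>l\<le>n.
    \<bar>mallows_cov n (q n) (at_most i k) (at_most j l)\<bar> < e)"
proof -
  define K where "K = exp (\<bar>\<beta>\<bar> + 1)"
  define J where "J = (\<lambda>n. 4 * K ^ 7 / real n + 2 * K ^ 15 * \<bar>1 - q n\<bar>)"
  have "J \<longlonglongrightarrow> 4 * K ^ 7 * 0 + 2 * K ^ 15 * \<bar>1 - 1\<bar>"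
    unfolding J_def divide_inverse
    by (intro tendsto_intros inverse_temperature_tendsto(1)[OF q lim] lim_inverse_n)
  then have J: "J \<longlonglongrightarrow> 0" by simp
  have "(\<lambda>n. 4 * K ^ 7 + 2 * K ^ 15 * \<bar>real n * (1 - q n)\<bar>) \<longlonglongrightarrow> 4 * K ^ 7 + 2 * K ^ 15 * \<bar>\<beta>\<bar>"
    by (intro tendsto_intros lim)
  then have nJ: "(\<lambda>n. real n * J n) \<longlonglongrightarrow> 4 * K ^ 7 + 2 * K ^ 15 * \<bar>\<beta>\<bar>"
    by (rule Lim_transform_eventually)
      (rule eventually_mono[OF eventually_gt_at_top[of 0]], simp add: J_def abs_mult distrib_left)
  have "(\<lambda>n. 2 * J n + 2 * (real n * J n) * J n) \<longlonglongrightarrow>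
      2 * 0 + 2 * (4 * K ^ 7 + 2 * K ^ 15 * \<bar>\<beta>\<bar>) * 0"
    by (intro tendsto_intros J nJ)
  then have "\<forall>\<^sub>F n in sequentially. dist (2 * J n + 2 * (real n * J n) * J n)
      (2 * 0 + 2 * (4 * K ^ 7 + 2 * K ^ 15 * \<bar>\<beta>\<bar>) * 0) < e"
    using e by (rule tendstoD)
  then show ?thesis using eventually_powers_within[OF q lim] eventually_ge_at_top[of 2]
  proof eventually_elim
    case (elim n)
    show ?case
    proof (intro ballI allI impI)
      fix i j k l assume "i \<in> {1..n}" "j \<in> {1..n}" "i \<noteq> j" "k \<le> n" "l \<le> n"
      then have "\<bar>mallows_cov n (q n) (at_most i k) (at_most j l)\<bar> \<le> 2 * J n + real n * (2 * J n * J n)"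
        using mallows_cov_at_most_bound[OF elim(2,3)] unfolding J_def K_def by blast
      also have "\<dots> = 2 * J n + 2 * (real n * J n) * J n" by simp
      also have "\<dots> < e" using elim(1) by (simp add: dist_real_def)
      finally show "\<bar>mallows_cov n (q n) (at_most i k) (at_most j l)\<bar> < e" .
    qed
  qed
qed

section \<open>From thresholds to Lipschitz functions\<close>

text \<open>
  Summation over all steps of \<open>F\<close> between \<open>v\<close> and \<open>n\<close>.  It reduces expectations and covariances of
  functions of a value to those of threshold events.
\<close>

lemma function_value_by_thresholds:
  fixes F :: "nat \<Rightarrow> real"
  assumes "1 \<le> v" "v \<le> n"
  shows "F v = F n - (\<Sum>k<n. (F (Suc k) - F k) * of_bool (v \<le> k))"
proof -
  have "(\<Sum>k<n. (F (Suc k) - F k) * of_bool (v \<le> k)) = (\<Sum>k=v..<n. F (Suc k) - F k)"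
    by (intro sum.mono_neutral_cong_right) auto
  also have "\<dots> = F n - F v" using assms by (simp add: sum_Suc_diff')
  finally show ?thesis by simp
qed

lemma function_of_value_eq:
  assumes "p \<in> sym_perms n" "i \<in> {1..n}"
  shows "F (p i) = F n - (\<Sum>k<n. (F (Suc k) - F k) * at_most i k p)"
  using function_value_by_thresholds[of "p i" n F] perm_in_range[OF assms] by (simp add: at_most_def)

lemma mallows_expectation_by_thresholds:
  fixes F :: "nat \<Rightarrow> real"
  assumes "q > 0" "i \<in> {1..n}"
  shows "mallows_expectation n q (\<lambda>p. F (p i)) = F n - (\<Sum>k<n. (F (Suc k) - F k) * mallows_cdf q n i k)"
proof -
  have "mallows_expectation n q (\<lambda>p. F (p i)) =
      mallows_expectation n q (\<lambda>p. F n - (\<Sum>k<n. (F (Suc k) - F k) * at_most i k p))"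
    by (intro mallows_expectation_cong function_of_value_eq assms)
  then show ?thesis
    by (simp add: mallows_expectation_diff mallows_expectation_const assms mallows_expectation_sum
        mallows_expectation_cmult mallows_cdf_def)
qed

lemma mallows_cov_by_thresholds:
  fixes F :: "nat \<Rightarrow> real"
  assumes "q > 0" "i \<in> {1..n}"
  shows "mallows_cov n q (\<lambda>p. F (p i)) h = - (\<Sum>k<n. (F (Suc k) - F k) * mallows_cov n q (at_most i k) h)"
proof -
  have "mallows_expectation n q (\<lambda>p. F (p i) * h p) =
     mallows_expectation n q (\<lambda>p. F n * h p - (\<Sum>k<n. (F (Suc k) - F k) * (at_most i k p * h p)))"
  proof (rule mallows_expectation_cong)
    fix p assume "p \<in> sym_perms n"
    then have "F (p i) = F n - (\<Sum>k<n. (F (Suc k) - F k) * at_most i k p)"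
      by (intro function_of_value_eq assms)
    then show "F (p i) * h p = F n * h p - (\<Sum>k<n. (F (Suc k) - F k) * (at_most i k p * h p))"
      by (simp add: left_diff_distrib sum_distrib_right mult.assoc)
  qed
  then show ?thesis
    unfolding mallows_cov_def mallows_expectation_by_thresholds[OF assms] mallows_cdf_def
      mallows_expectation_diff mallows_expectation_sum mallows_expectation_cmult
      right_diff_distrib left_diff_distrib sum_subtractf sum_distrib_right
    by (simp add: mult.assoc)
qed

text \<open>
  Bilinearity gives a double sum over pairs of thresholds, in which the \<open>n\<^sup>2\<close> coefficients of
  order \<open>1 / n\<^sup>2\<close> compensate for the number of terms.
\<close>

lemma mallows_cov_Lipschitz_bound:
  fixes F :: "nat \<Rightarrow> real"
  assumes "q > 0" "i \<in> {1..n}" "j \<in> {1..n}" and n: "n > 0" and "L \<ge> 0"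
    and F: "\<And>k. k < n \<Longrightarrow> \<bar>F (Suc k) - F k\<bar> \<le> L / real n"
    and c: "\<And>k l. k \<le> n \<Longrightarrow> l \<le> n \<Longrightarrow> \<bar>mallows_cov n q (at_most i k) (at_most j l)\<bar> \<le> c"
  shows "\<bar>mallows_cov n q (\<lambda>p. F (p i)) (\<lambda>p. F (p j))\<bar> \<le> L * (L * c)"
proof -
  have sum: "\<bar>\<Sum>k<n. (F (Suc k) - F k) * X k\<bar> \<le> L * d" if "\<And>k. k < n \<Longrightarrow> \<bar>X k\<bar> \<le> d" for X d
  proof -
    have "\<bar>\<Sum>k<n. (F (Suc k) - F k) * X k\<bar> \<le> (\<Sum>k<n. L / real n * d)"
      unfolding lessThan_iff[symmetric]
      by (intro order_trans[OF sum_abs] sum_mono, unfold abs_mult, intro mult_mono F that)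
        (use assms(5) in auto)
    then show ?thesis using n by simp
  qed
  have "\<bar>mallows_cov n q (at_most i k) (\<lambda>p. F (p j))\<bar> \<le> L * c" if "k < n" for k
    unfolding mallows_cov_commute[of n q "at_most i k"] mallows_cov_by_thresholds[OF assms(1,3)] abs_minus_cancel
    unfolding mallows_cov_commute[of n q "at_most j _"] using that by (intro sum c) auto
  then show ?thesis
    unfolding mallows_cov_by_thresholds[OF assms(1,2)] abs_minus_cancel by (rule sum)
qed

lemma lipschitz_grid_step:
  fixes f :: "real \<Rightarrow> real"
  assumes "L-lipschitz_on {0..1} f" "k < n"
  shows "\<bar>f (real (Suc k) / real n) - f (real k / real n)\<bar> \<le> L / real n"
proof -
  have "norm (f (real (Suc k) / real n) - f (real k / real n)) \<le> L * norm (real (Suc k) / real n - real k / real n)"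
    using assms(2) by (intro lipschitz_on_normD[OF assms(1)]) auto
  also have "real (Suc k) / real n - real k / real n = 1 / real n"
    by (simp flip: diff_divide_distrib)
  finally show ?thesis by simp
qed

text \<open>
  Summation by parts writes the expectation and the discretised integral in the same way, with the
  two distribution functions as the only difference.
\<close>

lemma mallows_expectation_Lipschitz_bound:
  fixes f :: "real \<Rightarrow> real"
  assumes "q > 0" and i: "i \<in> {1..n}" and L: "L-lipschitz_on {0..1} f"
    and c: "\<And>k. k \<le> n \<Longrightarrow> \<bar>mallows_cdf q n i k - limit_cdf \<beta> (real i / real n) (real k / real n)\<bar> \<le> c"
  shows "\<bar>mallows_expectation n q (\<lambda>p. f (real (p i) / real n))
      - integral {0..1} (\<lambda>y. f y * mallows_density (real i / real n) y \<beta>)\<bar> \<le> L / real n + L * c"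
proof -
  have n: "n > 0" using i by auto
  define x where "x = real i / real n"
  have x: "x \<in> {0..1}" using i by (auto simp: x_def)
  define F where "F = (\<lambda>k::nat. f (real k / real n))"
  define U where "U = (\<lambda>k::nat. limit_cdf \<beta> x (real k / real n))"
  have "\<bar>integral {0..real n / real n} (\<lambda>y. f y * mallows_density x y \<beta>)
      - (\<Sum>r<n. F (Suc r) * (U (Suc r) - U r))\<bar>
      \<le> L / real n * (limit_cdf \<beta> x (real n / real n) - limit_cdf \<beta> x 0)"
    unfolding F_def U_def
    by (intro stieltjes_sum_bound n L continuous_on_mallows_density x mallows_density_nonneg
        mallows_density_has_integral) auto
  then have 1: "\<bar>integral {0..1} (\<lambda>y. f y * mallows_density x y \<beta>) - (\<Sum>r<n. F (Suc r) * (U (Suc r) - U r))\<bar>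
      \<le> L / real n" using n by (simp add: limit_cdf_1[OF x])
  have "U 0 = 0" "U n = 1" using n by (simp_all add: U_def limit_cdf_1[OF x])
  then have 2: "(\<Sum>r<n. F (Suc r) * (U (Suc r) - U r)) = F n - (\<Sum>k<n. (F (Suc k) - F k) * U k)"
    by (subst summation_by_parts) auto
  have 3: "mallows_expectation n q (\<lambda>p. F (p i)) = F n - (\<Sum>k<n. (F (Suc k) - F k) * mallows_cdf q n i k)"
    by (rule mallows_expectation_by_thresholds[OF assms(1) i])
  have "\<bar>\<Sum>k<n. (F (Suc k) - F k) * (mallows_cdf q n i k - U k)\<bar> \<le> (\<Sum>k<n. L / real n * c)"
  proof (intro order_trans[OF sum_abs] sum_mono)
    fix k assume k: "k \<in> {..<n}"
    have "\<bar>F (Suc k) - F k\<bar> \<le> L / real n"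
      unfolding F_def by (rule lipschitz_grid_step[OF L]) (use k in auto)
    moreover have "\<bar>mallows_cdf q n i k - U k\<bar> \<le> c" unfolding U_def x_def using k by (intro c) auto
    ultimately show "\<bar>(F (Suc k) - F k) * (mallows_cdf q n i k - U k)\<bar> \<le> L / real n * c"
      unfolding abs_mult using lipschitz_on_nonneg[OF L] by (intro mult_mono) auto
  qed
  then have 4: "\<bar>(\<Sum>k<n. (F (Suc k) - F k) * mallows_cdf q n i k) - (\<Sum>k<n. (F (Suc k) - F k) * U k)\<bar> \<le> L * c"
    using n by (simp add: right_diff_distrib sum_subtractf)
  show ?thesis using 1 4 unfolding x_def[symmetric] 3[unfolded F_def] 2 unfolding F_def by linarith
qed

section \<open>From Lipschitz to continuous functions\<close>

lemma real_polynomial_function_lipschitz: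
  fixes g :: "real \<Rightarrow> real"
  assumes "real_polynomial_function g"
  obtains L where "L-lipschitz_on {0..1} g"
proof -
  obtain g' where g': "real_polynomial_function g'" "\<And>x. (g has_real_derivative g' x) (at x)"
    using has_real_derivative_polynomial_function[OF assms] by auto
  obtain g'' where "\<And>x. (g' has_real_derivative g'' x) (at x)"
    using has_real_derivative_polynomial_function[OF g'(1)] by auto
  then have "continuous_on {0..1} g'"
    by (intro continuous_at_imp_continuous_on ballI) (rule DERIV_isCont)
  then have "bounded (g' ` {0..1})" by (intro compact_imp_bounded compact_continuous_image) auto
  then obtain B where B: "B > 0" "\<And>x. x \<in> {0..1} \<Longrightarrow> norm (g' x) \<le> B"
    unfolding bounded_pos by auto
  have "B-lipschitz_on {0..1} g"
  proof (rule lipschitz_onI)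
    show "dist (g x) (g y) \<le> B * dist x y" if "x \<in> {0..1}" "y \<in> {0..1}" for x y
      unfolding dist_norm using that B(2) g'(2)
      by (intro field_differentiable_bound[of "{0..1}" g g']) (auto intro: has_field_derivative_at_within)
  qed (use B in simp)
  then show ?thesis by (rule that)
qed

text \<open>
  Polynomials are dense by the Weierstrass theorem, and Lipschitz on a bounded interval.
\<close>

lemma lipschitz_approximation:
  fixes f :: "real \<Rightarrow> real"
  assumes "continuous_on {0..1} f" "d > 0"
  obtains g L where "L-lipschitz_on {0..1} g" "\<And>x. x \<in> {0..1} \<Longrightarrow> \<bar>f x - g x\<bar> < d"
  using Stone_Weierstrass_real_polynomial_function[OF compact_Icc assms] real_polynomial_function_lipschitz
  by metis

lemma relative_value_in_unit_interval: "p \<in> sym_perms n \<Longrightarrow> i \<in> {1..n} \<Longrightarrow> real (p i) / real n \<in> {0..1}"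
  using perm_in_range by fastforce

lemma density_integral_approximation:
  assumes x: "x \<in> {0..1}" and f: "continuous_on {0..1} f" and g: "continuous_on {0..1} g"
    and fg: "\<And>y. y \<in> {0..1} \<Longrightarrow> \<bar>f y - g y\<bar> \<le> d"
  shows "\<bar>integral {0..1} (\<lambda>y. f y * mallows_density x y \<beta>)
    - integral {0..1} (\<lambda>y. g y * mallows_density x y \<beta>)\<bar> \<le> d"
proof -
  let ?u = "\<lambda>y. mallows_density x y \<beta>"
  have u: "(?u has_integral 1) {0..1}"
    using mallows_density_has_integral[OF x, of 0 1 \<beta>] by (simp add: limit_cdf_1[OF x])
  have int: "(\<lambda>y. h y * ?u y) integrable_on {0..1}" if "continuous_on {0..1} h" for h
    by (intro integrable_continuous_real continuous_on_mult that continuous_on_mallows_density x)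
  have "norm (integral {0..1} (\<lambda>y. f y * ?u y - g y * ?u y)) \<le> integral {0..1} (\<lambda>y. d * ?u y)"
  proof (rule integral_norm_bound_integral)
    show "norm (f y * ?u y - g y * ?u y) \<le> d * ?u y" if "y \<in> {0..1}" for y
      using fg[OF that] mallows_density_nonneg[of x y \<beta>]
      by (simp add: abs_mult mult_right_mono flip: left_diff_distrib)
  qed (use int[OF f] int[OF g] u in \<open>auto intro!: integrable_diff integrable_on_mult_right\<close>)
  also have "\<dots> = d" using u by (simp add: integral_unique)
  also have "integral {0..1} (\<lambda>y. f y * ?u y - g y * ?u y) =
      integral {0..1} (\<lambda>y. f y * ?u y) - integral {0..1} (\<lambda>y. g y * ?u y)"
    by (intro integral_diff int f g)
  finally show ?thesis by simp
qed

lemma abs_mult_diff_le: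
  fixes a b c d :: real
  assumes "\<bar>a - c\<bar> \<le> e" "\<bar>b - d\<bar> \<le> e" "\<bar>b\<bar> \<le> M" "\<bar>c\<bar> \<le> M'"
  shows "\<bar>a * b - c * d\<bar> \<le> e * (M + M')"
proof -
  have "\<bar>(a - c) * b\<bar> \<le> e * M" "\<bar>c * (b - d)\<bar> \<le> M' * e"
    unfolding abs_mult using assms by (intro mult_mono; linarith)+
  moreover have "a * b - c * d = (a - c) * b + c * (b - d)" by (simp add: algebra_simps)
  ultimately show ?thesis by (simp add: algebra_simps)
qed

lemma mallows_cov_approximation:
  assumes q: "q > 0"
    and "\<And>p. p \<in> sym_perms n \<Longrightarrow> \<bar>a p - a' p\<bar> \<le> d" "\<And>p. p \<in> sym_perms n \<Longrightarrow> \<bar>b p - b' p\<bar> \<le> d"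
    and M: "\<And>p. p \<in> sym_perms n \<Longrightarrow> \<bar>b p\<bar> \<le> M" "\<And>p. p \<in> sym_perms n \<Longrightarrow> \<bar>a' p\<bar> \<le> M'"
  shows "\<bar>mallows_cov n q a b - mallows_cov n q a' b'\<bar> \<le> 2 * (d * (M + M'))"
proof -
  have 1: "\<bar>mallows_expectation n q (\<lambda>p. a p * b p) - mallows_expectation n q (\<lambda>p. a' p * b' p)\<bar> \<le> d * (M + M')"
    unfolding mallows_expectation_diff[symmetric]
    by (intro abs_mallows_expectation_le q abs_mult_diff_le assms)
  have 2: "\<bar>mallows_expectation n q a * mallows_expectation n q b
      - mallows_expectation n q a' * mallows_expectation n q b'\<bar> \<le> d * (M + M')"
    by (intro abs_mult_diff_le; (unfold mallows_expectation_diff[symmetric])?; intro abs_mallows_expectation_le q assms)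
  show ?thesis using 1 2 unfolding mallows_cov_def by linarith
qed

lemma eventually_expectation_close:
  fixes q :: "nat \<Rightarrow> real" and f :: "real \<Rightarrow> real"
  assumes q: "\<forall>n\<ge>1. q n > 0" and lim: "(\<lambda>n. real n * (1 - q n)) \<longlonglongrightarrow> \<beta>"
    and f: "continuous_on {0..1} f" and e: "e > 0"
  shows "\<forall>\<^sub>F n in sequentially. \<forall>i\<in>{1..n}.
    \<bar>mallows_expectation n (q n) (\<lambda>p. f (real (p i) / real n))
      - integral {0..1} (\<lambda>y. f y * mallows_density (real i / real n) y \<beta>)\<bar> < e"
proof -
  obtain g L where L: "L-lipschitz_on {0..1} g" and g: "\<And>x. x \<in> {0..1} \<Longrightarrow> \<bar>f x - g x\<bar> < e / 4"
    using lipschitz_approximation[OF f, of "e / 4"] e by (metis divide_pos_pos zero_less_numeral)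
  have L0: "L \<ge> 0" by (rule lipschitz_on_nonneg[OF L])
  define c where "c = e / (4 * (L + 1))"
  have c: "c > 0" "L * c \<le> e / 4" using e L0 by (auto simp: c_def field_simps)
  have "(\<lambda>n. L / real n) \<longlonglongrightarrow> 0" by (rule lim_const_over_n)
  then have "\<forall>\<^sub>F n in sequentially. dist (L / real n) 0 < e / 4" by (rule tendstoD) (use e in simp)
  then show ?thesis using mallows_cdf_uniform_limit[OF q lim c(1)] eventually_ge_at_top[of 1]
  proof eventually_elim
    case (elim n)
    have qn: "q n > 0" using q elim by simp
    show ?case
    proof
      fix i assume i: "i \<in> {1..n}"
      let ?I = "\<lambda>h. integral {0..1} (\<lambda>y. h y * mallows_density (real i / real n) y \<beta>)"
      let ?E = "\<lambda>h. mallows_expectation n (q n) (\<lambda>p. h (real (p i) / real n))"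
      have "\<bar>?E g - ?I g\<bar> \<le> L / real n + L * c"
        using elim(2) i by (intro mallows_expectation_Lipschitz_bound qn L) (auto intro: less_imp_le)
      moreover have "\<bar>?I f - ?I g\<bar> \<le> e / 4"
        using i by (intro density_integral_approximation f lipschitz_on_continuous_on[OF L] less_imp_le[OF g]) auto
      moreover have "\<bar>?E f - ?E g\<bar> \<le> e / 4"
        unfolding mallows_expectation_diff[symmetric]
        by (intro abs_mallows_expectation_le qn less_imp_le[OF g] relative_value_in_unit_interval i)
      moreover have "L / real n < e / 4" using elim(1) L0 by simp
      ultimately show "\<bar>?E f - ?I f\<bar> < e" using c(2) by linarith
    qed
  qed
qed

lemma eventually_cov_small:
  fixes q :: "nat \<Rightarrow> real" and f :: "real \<Rightarrow> real"
  assumes q: "\<forall>n\<ge>1. q n > 0" and lim: "(\<lambda>n. real n * (1 - q n)) \<longlonglongrightarrow> \<beta>"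
    and f: "continuous_on {0..1} f" and e: "e > 0"
  shows "\<forall>\<^sub>F n in sequentially. \<forall>i\<in>{1..n}. \<forall>j\<in>{1..n}. i \<noteq> j \<longrightarrow>
    \<bar>mallows_cov n (q n) (\<lambda>p. f (real (p i) / real n)) (\<lambda>p. f (real (p j) / real n))\<bar> < e"
proof -
  have "bounded (f ` {0..1})" using f by (intro compact_imp_bounded compact_continuous_image) auto
  then obtain M where M: "M > 0" "\<And>x. x \<in> {0..1} \<Longrightarrow> \<bar>f x\<bar> \<le> M"
    unfolding bounded_pos by auto
  \<comment> \<open>Replacing \<open>f\<close> by a function at distance \<open>d\<close>, itself bounded by \<open>M + 1\<close>, costs at most \<open>e / 2\<close>.\<close>
  define d where "d = min 1 (e / (4 * (M + (M + 1))))"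
  have d: "d > 0" "d \<le> 1" using e M by (auto simp: d_def)
  have "d * (4 * (M + (M + 1))) \<le> e / (4 * (M + (M + 1))) * (4 * (M + (M + 1)))"
    using M by (intro mult_right_mono) (auto simp: d_def)
  also have "\<dots> = e" using M by simp
  finally have d': "2 * (d * (M + (M + 1))) \<le> e / 2" by (simp add: algebra_simps)
  obtain g L where L: "L-lipschitz_on {0..1} g" and g: "\<And>x. x \<in> {0..1} \<Longrightarrow> \<bar>f x - g x\<bar> < d"
    using lipschitz_approximation[OF f d(1)] by metis
  have gM: "\<bar>g x\<bar> \<le> M + 1" if "x \<in> {0..1}" for x using g[OF that] M(2)[OF that] d by linarith
  have L0: "L \<ge> 0" by (rule lipschitz_on_nonneg[OF L])
  define c where "c = e / 4 / (L * L + 1)"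
  have pos: "L * L + 1 > 0" using L0 by (simp add: add_nonneg_pos)
  have c: "c > 0" using e pos by (simp add: c_def)
  have "L * (L * c) \<le> (L * L + 1) * c" using c by (simp add: algebra_simps)
  also have "\<dots> = e / 4"
    using nonzero_mult_div_cancel_left[of "L * L + 1" "e / 4"] pos unfolding c_def by (simp only: times_divide_eq_right)
  finally have c': "L * (L * c) \<le> e / 4" .
  show ?thesis using mallows_cov_at_most_uniform_limit[OF q lim c] eventually_ge_at_top[of 1]
  proof eventually_elim
    case (elim n)
    have qn: "q n > 0" using q elim by simp
    show ?case
    proof (intro ballI impI)
      fix i j assume ij: "i \<in> {1..n}" "j \<in> {1..n}" "i \<noteq> j"
      let ?C = "\<lambda>h. mallows_cov n (q n) (\<lambda>p. h (real (p i) / real n)) (\<lambda>p. h (real (p j) / real n))"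
      have "\<bar>?C g\<bar> \<le> L * (L * c)"
        using elim ij by (intro mallows_cov_Lipschitz_bound[where F = "\<lambda>k. g (real k / real n)"] qn
            lipschitz_grid_step[OF L] L0 less_imp_le[OF elim(1)[rule_format]]) auto
      moreover have "\<bar>?C f - ?C g\<bar> \<le> 2 * (d * (M + (M + 1)))"
        by (intro mallows_cov_approximation qn less_imp_le[OF g] M(2) gM relative_value_in_unit_interval ij)
      ultimately show "\<bar>?C f\<bar> < e" using c' d' e by linarith
    qed
  qed
qed

lemma Max_tendsto_0:
  fixes h :: "nat \<Rightarrow> 'a \<Rightarrow> real"
  assumes "\<And>n. finite (S n)" "\<forall>\<^sub>F n in sequentially. S n \<noteq> {}" "\<And>n s. h n s \<ge> 0"
    and small: "\<And>e. e > 0 \<Longrightarrow> \<forall>\<^sub>F n in sequentially. \<forall>s\<in>S n. h n s < e"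
  shows "(\<lambda>n. Max (h n ` S n)) \<longlonglongrightarrow> 0"
proof (rule tendstoI)
  fix e :: real assume "e > 0"
  show "\<forall>\<^sub>F n in sequentially. dist (Max (h n ` S n)) 0 < e"
    using small[OF \<open>e > 0\<close>] assms(2)
  proof eventually_elim
    case (elim n)
    then have "Max (h n ` S n) \<in> h n ` S n" using assms(1) by (intro Max_in) auto
    then show ?case using elim(1) assms(3) by auto
  qed
qed

theorem theorem2:
  fixes q :: "nat \<Rightarrow> real" and \<beta> :: real and f :: "real \<Rightarrow> real"
  assumes "\<And>n. n \<ge> 1 \<Longrightarrow> q n > 0"
    and "(\<lambda>n. real n * (1 - q n)) \<longlonglongrightarrow> \<beta>"
    and "continuous_on {0..1} f"
  shows "((\<lambda>n. MAX i\<in>{1..n}.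
            \<bar>mallows_expectation n (q n) (\<lambda>p. f (real (p i) / real n))
              - integral {0..1} (\<lambda>y. f y * mallows_density (real i / real n) y \<beta>)\<bar>)
           \<longlonglongrightarrow> 0)
       \<and> ((\<lambda>n. MAX (i, j)\<in>{(i, j). i \<in> {1..n} \<and> j \<in> {1..n} \<and> i \<noteq> j}.
            \<bar>mallows_cov n (q n) (\<lambda>p. f (real (p i) / real n)) (\<lambda>p. f (real (p j) / real n))\<bar>)
           \<longlonglongrightarrow> 0)"
proof
  have q: "\<forall>n\<ge>1. q n > 0" using assms(1) by blast
  show "(\<lambda>n. MAX i\<in>{1..n}.
            \<bar>mallows_expectation n (q n) (\<lambda>p. f (real (p i) / real n))
              - integral {0..1} (\<lambda>y. f y * mallows_density (real i / real n) y \<beta>)\<bar>)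
           \<longlonglongrightarrow> 0"
  proof (rule Max_tendsto_0)
    show "\<forall>\<^sub>F n in sequentially. {1..n} \<noteq> {}"
      using eventually_ge_at_top[of 1] by eventually_elim simp
  qed (use eventually_expectation_close[OF q assms(2,3)] in auto)
  show "(\<lambda>n. MAX (i, j)\<in>{(i, j). i \<in> {1..n} \<and> j \<in> {1..n} \<and> i \<noteq> j}.
            \<bar>mallows_cov n (q n) (\<lambda>p. f (real (p i) / real n)) (\<lambda>p. f (real (p j) / real n))\<bar>)
           \<longlonglongrightarrow> 0"
  proof (rule Max_tendsto_0)
    show "finite {(i, j). i \<in> {1..n} \<and> j \<in> {1..n} \<and> i \<noteq> j}" for n :: nat
      by (rule finite_subset[of _ "{1..n} \<times> {1..n}"]) auto
    show "\<forall>\<^sub>F n in sequentially. {(i, j). i \<in> {1..n} \<and> j \<in> {1..n} \<and> i \<noteq> j} \<noteq> {}"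
      using eventually_ge_at_top[of 2]
    proof eventually_elim
      case (elim n)
      then have "(1, 2) \<in> {(i, j). i \<in> {1..n} \<and> j \<in> {1..n} \<and> i \<noteq> j}" by auto
      then show ?case by blast
    qed
    show "\<forall>\<^sub>F n in sequentially. \<forall>s\<in>{(i, j). i \<in> {1..n} \<and> j \<in> {1..n} \<and> i \<noteq> j}.
      (case s of (i, j) \<Rightarrow>
        \<bar>mallows_cov n (q n) (\<lambda>p. f (real (p i) / real n)) (\<lambda>p. f (real (p j) / real n))\<bar>) < e"
      if "e > 0" for e
      using eventually_cov_small[OF q assms(2,3) that] by eventually_elim auto
  qed auto
qed

end
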